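(* Let $r\ge 1$ and let $a_1,\ldots,a_r:\mathbb{Z}_{\ge1}\to\mathbb{C}$ be arithmetic functions such that for each $j$ there is a positive real $\alpha_j$ with $\left|\sum_{m\le t}a_j(m)\right|\le\alpha_j$ for every $t\ge1$. Define the iterated series (summed first over $n_r$, then $n_{r-1}$, ..., finally $n_1$) $$\Phi(s_1,\ldots,s_r;a_1,\ldots,a_r)=\sum_{n_1=1}^{\infty}\sum_{n_2=1}^{\infty}\cdots\sum_{n_r=1}^{\infty}\frac{a_1(n_1)a_2(n_2)\cdots a_r(n_r)}{n_1^{s_1}(n_1+n_2)^{s_2}\cdots(n_1+\cdots+n_r)^{s_r}}.$$ Then $\Phi$ is (conditionally) convergent in the region $\mathcal{D}=\{(s_1,\ldots,s_r)\in\mathbb{C}^r:\ \sigma_r+\sigma_{r-1}+\cdots+\sigma_{r-i}>0\text{ for }0\le i\le r-1\}$, where $\sigma_i=\Re(s_i)$, and in $\mathcal{D}$ $$\Phi(s_1,\ldots,s_r;a_1,\ldots,a_r)=\int_{1}^\infty\cdots\int_{1}^\infty\prod_{i=1}^r\Big(\sum_{n_i\le t_i}a_i(n_i)\Big)\left(\sum_{\substack{k_1+\cdots+k_r=r\\ k_1+\cdots+k_i\le i,\ 1\le i\le r\\ 0\le k_i\le i,\ 1\le i\le r}}\binom{1}{k_1}\prod_{i=2}^r\binom{i-k_1-\cdots-k_{i-1}}{k_i}\prod_{i=1}^r\frac{(s_i)_{k_i}}{\big(\sum_{j=1}^i t_j\big)^{s_i+k_i}}\right)dt_r\,dt_{r-1}\cdots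 dt_1,$$ with iterated integrals (innermost over $t_r$, outermost over $t_1$) and the sum over integer tuples.
   Context: $(s)_k=s(s+1)\cdots(s+k-1)$ for positive integers $k$ and $(s)_0=1$. Binomial coefficients $\binom{n}{k}$ are $0$ if $k<0$ or $k>n$. Powers $a^{s}$ with $a>0$ real denote $e^{s\log a}$. *)

theory Defs
  imports "HOL-Analysis.Analysis"
begin

text \<open>
  Iterated series and integrals act on functions of an assignment of values to indexed
  variables.  The list gives the variables in order, outermost first; the assignment passed
  along holds the values already fixed by the outer operators.  All summation variables range
  over the positive integers (hence \<open>Suc m\<close>), all integration variables over \<open>[1, \<infinity>)\<close>.
\<close>

primrec iter_suminf :: "nat list \<Rightarrow> ((nat \<Rightarrow> nat) \<Rightarrow> complex) \<Rightarrow> (nat \<Rightarrow> nat) \<Rightarrow> complex" where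
  "iter_suminf [] F n = F n"
| "iter_suminf (j # js) F n = (\<Sum>m. iter_suminf js F (n(j := Suc m)))"

text \<open>
  Convergence of an iterated series: each inner iterated series converges for all values of
  the outer variables, and the outermost series of their values converges (not necessarily
  absolutely).
\<close>

primrec iter_summable :: "nat list \<Rightarrow> ((nat \<Rightarrow> nat) \<Rightarrow> complex) \<Rightarrow> (nat \<Rightarrow> nat) \<Rightarrow> bool" where
  "iter_summable [] F n \<longleftrightarrow> True"
| "iter_summable (j # js) F n \<longleftrightarrow>
     (\<forall>m. iter_summable js F (n(j := Suc m))) \<and>
     summable (\<lambda>m. iter_suminf js F (n(j := Suc m)))"

primrec iter_integral :: "nat list \<Rightarrow> ((nat \<Rightarrow> real) \<Rightarrow> complex) \<Rightarrow> (nat \<Rightarrow> real) \<Rightarrow> complex" where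
  "iter_integral [] F t = F t"
| "iter_integral (j # js) F t = (LINT x:{1..}|lborel. iter_integral js F (t(j := x)))"

primrec iter_integrable :: "nat list \<Rightarrow> ((nat \<Rightarrow> real) \<Rightarrow> complex) \<Rightarrow> (nat \<Rightarrow> real) \<Rightarrow> bool" where
  "iter_integrable [] F t \<longleftrightarrow> True"
| "iter_integrable (j # js) F t \<longleftrightarrow>
     (\<forall>x\<ge>1. iter_integrable js F (t(j := x))) \<and>
     set_integrable lborel {1..} (\<lambda>x. iter_integral js F (t(j := x)))"

text \<open>An \<open>r\<close>-tuple is a function on \<open>nat\<close> of which only the values at \<open>1, \<dots>, r\<close> are used.\<close>

definition Phi_term ::
  "nat \<Rightarrow> (nat \<Rightarrow> complex) \<Rightarrow> (nat \<Rightarrow> nat \<Rightarrow> complex) \<Rightarrow> (nat \<Rightarrow> nat) \<Rightarrow> complex" where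
  "Phi_term r s a n =
     (\<Prod>i=1..r. a i (n i)) / (\<Prod>i=1..r. of_nat (\<Sum>j=1..i. n j) powr s i)"

text \<open>The initial assignment is irrelevant: all variables \<open>1, \<dots>, r\<close> get overwritten.\<close>

definition Phi_convergent ::
  "nat \<Rightarrow> (nat \<Rightarrow> complex) \<Rightarrow> (nat \<Rightarrow> nat \<Rightarrow> complex) \<Rightarrow> bool" where
  "Phi_convergent r s a \<longleftrightarrow> iter_summable [1..<Suc r] (Phi_term r s a) (\<lambda>_. 0)"

definition Phi ::
  "nat \<Rightarrow> (nat \<Rightarrow> complex) \<Rightarrow> (nat \<Rightarrow> nat \<Rightarrow> complex) \<Rightarrow> complex" where
  "Phi r s a = iter_suminf [1..<Suc r] (Phi_term r s a) (\<lambda>_. 0)"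

definition partial_sum :: "(nat \<Rightarrow> complex) \<Rightarrow> real \<Rightarrow> complex" where
  "partial_sum b t = (\<Sum>m | 1 \<le> m \<and> real m \<le> t. b m)"

definition region_D :: "nat \<Rightarrow> (nat \<Rightarrow> complex) set" where
  "region_D r = {s. \<forall>i\<le>r - 1. (\<Sum>j=r-i..r. Re (s j)) > 0}"

text \<open>
  Since \<open>k\<^sub>i \<ge> 0\<close>, the integer tuples are tuples of naturals; extensionality represents each
  tuple by exactly one function.
\<close>

definition index_tuples :: "nat \<Rightarrow> (nat \<Rightarrow> nat) set" where
  "index_tuples r =
     {k \<in> (\<Pi>\<^sub>E i\<in>{1..r}. {0..i}). (\<Sum>i=1..r. k i) = r \<and> (\<forall>i\<in>{1..r}. (\<Sum>j=1..i. k j) \<le> i)}"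

text \<open>
  On \<open>index_tuples r\<close> the natural-number subtraction below never truncates, as
  \<open>k\<^sub>1 + \<dots> + k\<^sub>i\<^sub>-\<^sub>1 \<le> i - 1\<close>.
\<close>

definition kernel :: "nat \<Rightarrow> (nat \<Rightarrow> complex) \<Rightarrow> (nat \<Rightarrow> real) \<Rightarrow> complex" where
  "kernel r s t =
     (\<Sum>k\<in>index_tuples r.
        of_nat (1 choose k 1) *
        (\<Prod>i=2..r. of_nat ((i - (\<Sum>j=1..<i. k j)) choose k i)) *
        (\<Prod>i=1..r. pochhammer (s i) (k i) /
                   complex_of_real (\<Sum>j=1..i. t j) powr (s i + of_nat (k i))))"

definition Phi_integrand ::
  "nat \<Rightarrow> (nat \<Rightarrow> complex) \<Rightarrow> (nat \<Rightarrow> nat \<Rightarrow> complex) \<Rightarrow> (nat \<Rightarrow> real) \<Rightarrow> complex" where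
  "Phi_integrand r s a t = (\<Prod>i=1..r. partial_sum (a i) (t i)) * kernel r s t"

end

theory Submission
  imports Defs "HOL-Library.Poly_Mapping"
begin

text \<open>
  The kernel is \<open>(-1)\<^sup>r \<partial>\<^sub>1 \<dots> \<partial>\<^sub>r\<close> of \<open>T\<^sub>1 powr - s\<^sub>1 \<dots> T\<^sub>r powr - s\<^sub>r\<close>, where \<open>T\<^sub>i = t\<^sub>1 + \<dots> + t\<^sub>i\<close>:
  the operator \<open>-\<partial>\<^sub>j\<close> raises the exponent of one of the factors \<open>j, \<dots>, r\<close>, so formally the kernel is
  the image of \<open>\<Prod>\<^sub>j (x\<^sub>j + \<dots> + x\<^sub>r)\<close>, which the binomial theorem, applied to one variable after
  another, expands with the stated coefficients.  Hence the term of the series at \<open>n\<close> is the iterated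
  integral of the kernel against \<open>\<Prod>\<^sub>i a\<^sub>i(n\<^sub>i) [n\<^sub>i \<le> t\<^sub>i]\<close>, and summing over \<open>n\<^sub>i < N\<close> turns the
  \<open>i\<close>-th weight into a bounded truncation of the partial sum function of \<open>a\<^sub>i\<close>.  As the \<open>T\<^sub>i\<close> increase,
  the kernel is at most a constant times \<open>\<Prod>\<^sub>i T\<^sub>i powr - (\<sigma>\<^sub>i + 1)\<close>, whose iterated integral
  is finite, so dominated convergence allows \<open>N \<longrightarrow> \<infinity>\<close> in each sum.
\<close>

section \<open>Dominated iterated integrals\<close>

text \<open>Assignments are total functions, so this is the measurable space on all coordinates; the
  dependence of an iterated integral on its outer variables becomes measurability on it.\<close>

abbreviation assignments :: "(nat \<Rightarrow> real) measure" where
  "assignments \<equiv> PiM UNIV (\<lambda>_. borel)"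

text \<open>Joint measurability in the assignment and the new value makes each inner integral a
  measurable function of the outer variables.\<close>

lemma measurable_fun_upd_assignments:
  "(\<lambda>(t, x). t(j := x)) \<in> assignments \<Otimes>\<^sub>M lborel \<rightarrow>\<^sub>M assignments"
proof -
  have "(\<lambda>p i. ((fst p)(j := snd p)) i) \<in> assignments \<Otimes>\<^sub>M lborel \<rightarrow>\<^sub>M assignments"
  proof (rule measurable_PiM_single')
    fix i
    have "(\<lambda>p. fst p i) \<in> borel_measurable (assignments \<Otimes>\<^sub>M (lborel :: real measure))"
      by (rule measurable_compose[OF measurable_fst measurable_component_singleton]) simp
    then show "(\<lambda>p. ((fst p)(j := snd p)) i) \<in> assignments \<Otimes>\<^sub>M lborel \<rightarrow>\<^sub>M borel"
      by (cases "i = j") auto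
  qed auto
  then show ?thesis
    by (simp add: case_prod_beta' del: fun_upd_apply)
qed

lemma iter_integral_measurable:
  assumes "F \<in> borel_measurable assignments"
  shows "iter_integral js F \<in> borel_measurable assignments"
proof (induction js)
  case Nil
  then show ?case using assms by simp
next
  case (Cons j js)
  have [measurable]: "(\<lambda>p. iter_integral js F ((fst p)(j := snd p)))
      \<in> borel_measurable (assignments \<Otimes>\<^sub>M lborel)"
    using measurable_compose[OF measurable_fun_upd_assignments Cons]
    by (simp add: case_prod_beta' del: fun_upd_apply)
  show ?case
    unfolding iter_integral.simps set_lebesgue_integral_def
    by (rule lborel.borel_measurable_lebesgue_integral) (simp add: case_prod_beta' del: fun_upd_apply)
qed

primrec iter_nn_integral :: "nat list \<Rightarrow> ((nat \<Rightarrow> real) \<Rightarrow> ennreal) \<Rightarrow> (nat \<Rightarrow> real) \<Rightarrow> ennreal" where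
  "iter_nn_integral [] H t = H t"
| "iter_nn_integral (j # js) H t = (\<integral>\<^sup>+x\<in>{1..}. iter_nn_integral js H (t(j := x)) \<partial>lborel)"

text \<open>Finiteness is demanded for every \<open>x \<ge> 1\<close> at every level, not almost
  everywhere, because \<open>iter_integrable\<close> makes the same demand of the inner
  integrals.\<close>

primrec iter_nn_finite :: "nat list \<Rightarrow> ((nat \<Rightarrow> real) \<Rightarrow> ennreal) \<Rightarrow> (nat \<Rightarrow> real) \<Rightarrow> bool" where
  "iter_nn_finite [] H t \<longleftrightarrow> H t < \<infinity>"
| "iter_nn_finite (j # js) H t \<longleftrightarrow>
     (\<forall>x\<ge>1. iter_nn_finite js H (t(j := x))) \<and> iter_nn_integral (j # js) H t < \<infinity>"

lemma iter_nn_finiteD: "iter_nn_finite js H t \<Longrightarrow> iter_nn_integral js H t < \<infinity>"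
  by (cases js) auto

lemma iter_nn_integral_measurable:
  assumes "H \<in> borel_measurable assignments"
  shows "iter_nn_integral js H \<in> borel_measurable assignments"
proof (induction js)
  case Nil
  then show ?case using assms by simp
next
  case (Cons j js)
  have [measurable]: "(\<lambda>p. iter_nn_integral js H ((fst p)(j := snd p)))
      \<in> borel_measurable (assignments \<Otimes>\<^sub>M lborel)"
    using measurable_compose[OF measurable_fun_upd_assignments Cons]
    by (simp add: case_prod_beta' del: fun_upd_apply)
  show ?case
    unfolding iter_nn_integral.simps
    by (rule lborel.borel_measurable_nn_integral) (simp add: case_prod_beta' del: fun_upd_apply)
qed

lemma measurable_fun_upd_const: "(\<lambda>x. t(j := x)) \<in> lborel \<rightarrow>\<^sub>M assignments"
  using measurable_compose[OF measurable_Pair1' measurable_fun_upd_assignments, of t j]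
  by (simp add: space_PiM)

text \<open>\<open>S\<close> collects the variables already placed in the range of integration;
  pointwise hypotheses on an integrand are imposed only there.\<close>

definition coords_ge1 :: "nat set \<Rightarrow> (nat \<Rightarrow> real) set" where
  "coords_ge1 S = {t. \<forall>i\<in>S. 1 \<le> t i}"

lemma coords_ge1_upd: "t \<in> coords_ge1 S \<Longrightarrow> 1 \<le> x \<Longrightarrow> t(j := x) \<in> coords_ge1 (insert j S)"
  by (auto simp: coords_ge1_def)

lemma iter_integral_norm_le:
  assumes "t \<in> coords_ge1 S"
    and "\<And>u. u \<in> coords_ge1 (S \<union> set js) \<Longrightarrow> ennreal (norm (F u)) \<le> H u"
  shows "ennreal (norm (iter_integral js F t)) \<le> iter_nn_integral js H t"
  using assms
proof (induction js arbitrary: S t)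
  case Nil
  then show ?case by simp
next
  case (Cons j js)
  have *: "ennreal (norm (iter_integral js F (t(j := x)))) \<le> iter_nn_integral js H (t(j := x))"
    if "1 \<le> x" for x
    using Cons.prems by (intro Cons.IH[OF coords_ge1_upd[OF _ that]]) (auto simp del: fun_upd_apply)
  let ?f = "\<lambda>x. indicat_real {1..} x *\<^sub>R iter_integral js F (t(j := x))"
  show ?case
  proof (cases "integrable lborel ?f")
    case True
    have "ennreal (norm (LINT x|lborel. ?f x)) \<le> (\<integral>\<^sup>+x. norm (?f x) \<partial>lborel)"
      by (rule integral_norm_bound_ennreal[OF True])
    also have "\<dots> \<le> iter_nn_integral (j # js) H t"
      unfolding iter_nn_integral.simps
      by (intro nn_integral_mono) (auto simp: indicator_def *)
    finally show ?thesis
      by (simp add: set_lebesgue_integral_def)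
  next
    \<comment> \<open>The Bochner integral of a non-integrable function is 0 by convention, so the
      bound is trivial.\<close>
    case False
    then show ?thesis
      by (simp add: set_lebesgue_integral_def not_integrable_integral_eq)
  qed
qed

lemma iter_integrable_dominated:
  assumes "t \<in> coords_ge1 S"
    and F: "F \<in> borel_measurable assignments"
    and "\<And>u. u \<in> coords_ge1 (S \<union> set js) \<Longrightarrow> ennreal (norm (F u)) \<le> H u"
    and "iter_nn_finite js H t"
  shows "iter_integrable js F t"
  using assms(1,3,4)
proof (induction js arbitrary: S t)
  case Nil
  then show ?case by simp
next
  case (Cons j js)
  have "iter_integrable js F (t(j := x))" if "1 \<le> x" for x
    using Cons.prems that by (intro Cons.IH[OF coords_ge1_upd[OF _ that]]) (auto simp del: fun_upd_apply)
  moreover have "set_integrable lborel {1..} (\<lambda>x. iter_integral js F (t(j := x)))"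
    unfolding set_integrable_def
  proof (rule integrableI_bounded)
    have [measurable]: "(\<lambda>x. iter_integral js F (t(j := x))) \<in> borel_measurable lborel"
      by (rule measurable_compose[OF measurable_fun_upd_const iter_integral_measurable[OF F]])
    show "(\<lambda>x. indicat_real {1..} x *\<^sub>R iter_integral js F (t(j := x))) \<in> borel_measurable lborel"
      by measurable
    have "ennreal (norm (iter_integral js F (t(j := x)))) \<le> iter_nn_integral js H (t(j := x))"
      if "1 \<le> x" for x
      using Cons.prems by (intro iter_integral_norm_le[OF coords_ge1_upd[OF _ that]]) auto
    then have "(\<integral>\<^sup>+x. norm (indicat_real {1..} x *\<^sub>R iter_integral js F (t(j := x))) \<partial>lborel)
        \<le> iter_nn_integral (j # js) H t"
      unfolding iter_nn_integral.simps by (intro nn_integral_mono) (auto simp: indicator_def)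
    also have "\<dots> < \<infinity>"
      using Cons.prems by simp
    finally show "(\<integral>\<^sup>+x. norm (indicat_real {1..} x *\<^sub>R iter_integral js F (t(j := x))) \<partial>lborel) < \<infinity>" .
  qed
  ultimately show ?case by simp
qed

text \<open>The induction peels off the outermost integral: the inner integrals converge for each
  \<open>x \<ge> 1\<close> and are dominated by the inner iterated integral of \<open>H\<close>,
  whose integral over \<open>x\<close> is finite.\<close>

lemma iter_integral_dominated_convergence:
  fixes F :: "nat \<Rightarrow> (nat \<Rightarrow> real) \<Rightarrow> complex"
  assumes "t \<in> coords_ge1 S"
    and F: "\<And>N. F N \<in> borel_measurable assignments" and G: "G \<in> borel_measurable assignments"
    and H: "H \<in> borel_measurable assignments"
    and "\<And>N u. u \<in> coords_ge1 (S \<union> set js) \<Longrightarrow> ennreal (norm (F N u)) \<le> H u"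
    and "\<And>u. u \<in> coords_ge1 (S \<union> set js) \<Longrightarrow> (\<lambda>N. F N u) \<longlonglongrightarrow> G u"
    and "iter_nn_finite js H t"
  shows "(\<lambda>N. iter_integral js (F N) t) \<longlonglongrightarrow> iter_integral js G t"
  using assms(1,5,6,7)
proof (induction js arbitrary: S t)
  case Nil
  then show ?case by simp
next
  case (Cons j js)
  have lim: "(\<lambda>N. iter_integral js (F N) (t(j := x))) \<longlonglongrightarrow> iter_integral js G (t(j := x))"
    if "1 \<le> x" for x
    using Cons.prems that by (intro Cons.IH[OF coords_ge1_upd[OF _ that]]) (auto simp del: fun_upd_apply)
  have bound: "ennreal (norm (iter_integral js (F N) (t(j := x)))) \<le> iter_nn_integral js H (t(j := x))"
    if "1 \<le> x" for x N
    using Cons.prems by (intro iter_integral_norm_le[OF coords_ge1_upd[OF _ that]]) auto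
  have fin: "iter_nn_integral js H (t(j := x)) < \<infinity>" if "1 \<le> x" for x
    using Cons.prems that iter_nn_finiteD[of js H "t(j := x)"] by (simp del: fun_upd_apply)
  note [measurable] =
    measurable_compose[OF measurable_fun_upd_const iter_integral_measurable[OF F]]
    measurable_compose[OF measurable_fun_upd_const iter_integral_measurable[OF G]]
    measurable_compose[OF measurable_fun_upd_const iter_nn_integral_measurable[OF H]]
  \<comment> \<open>The majorant has to be real-valued; \<open>enn2real\<close> loses nothing since
    the inner integrals of \<open>H\<close> are finite for \<open>x \<ge> 1\<close>.\<close>
  let ?w = "\<lambda>x. indicat_real {1..} x * enn2real (iter_nn_integral js H (t(j := x)))"
  show ?case
    unfolding iter_integral.simps set_lebesgue_integral_def
  proof (rule integral_dominated_convergence[where w = ?w])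
    show "integrable lborel ?w"
    proof (rule integrableI_bounded)
      have "(\<integral>\<^sup>+x. ennreal (norm (?w x)) \<partial>lborel) \<le> iter_nn_integral (j # js) H t"
        unfolding iter_nn_integral.simps
        by (intro nn_integral_mono) (auto simp: indicator_def fin[unfolded infinity_ennreal_def] simp del: fun_upd_apply)
      also have "\<dots> < \<infinity>"
        using Cons.prems by simp
      finally show "(\<integral>\<^sup>+x. ennreal (norm (?w x)) \<partial>lborel) < \<infinity>" .
    qed measurable
    have "norm (iter_integral js (F N) (t(j := x))) \<le> enn2real (iter_nn_integral js H (t(j := x)))"
      if "1 \<le> x" for x N
      using enn2real_mono[OF bound[OF that]] fin[OF that] by simp
    then show "AE x in lborel. norm (indicat_real {1..} x *\<^sub>R iter_integral js (F N) (t(j := x))) \<le> ?w x" for N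
      by (auto simp: indicator_def)
    show "AE x in lborel. (\<lambda>N. indicat_real {1..} x *\<^sub>R iter_integral js (F N) (t(j := x)))
        \<longlonglongrightarrow> indicat_real {1..} x *\<^sub>R iter_integral js G (t(j := x))"
      using lim by (auto simp: indicator_def)
  qed measurable
qed

lemma iter_integral_sum:
  assumes "\<And>m. m \<in> A \<Longrightarrow> iter_integrable js (F m) t"
  shows "iter_integral js (\<lambda>u. \<Sum>m\<in>A. F m u) t = (\<Sum>m\<in>A. iter_integral js (F m) t)"
  using assms
proof (induction js arbitrary: t)
  case Nil
  then show ?case by simp
next
  case (Cons j js)
  have "iter_integral (j # js) (\<lambda>u. \<Sum>m\<in>A. F m u) t
      = (LINT x:{1..}|lborel. \<Sum>m\<in>A. iter_integral js (F m) (t(j := x)))"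
    unfolding iter_integral.simps
    by (intro set_lebesgue_integral_cong allI impI Cons.IH) (use Cons.prems in \<open>auto simp del: fun_upd_apply\<close>)
  also have "\<dots> = (\<Sum>m\<in>A. iter_integral (j # js) (F m) t)"
    unfolding iter_integral.simps set_lebesgue_integral_def scaleR_sum_right
    using Cons.prems
    by (intro Bochner_Integration.integral_sum) (simp add: set_integrable_def)
  finally show ?case .
qed

lemma iter_integral_cmult: "iter_integral js (\<lambda>u. c * F u) t = c * iter_integral js F t"
proof (induction js arbitrary: t)
  case (Cons j js)
  then show ?case
    by (simp add: set_lebesgue_integral_def del: fun_upd_apply flip: mult_scaleR_right)
qed simp

section \<open>The generating polynomial of the kernel\<close>

text \<open>Umbral evaluation: the linear map on polynomials, with exponents as keys, that replaces
  the monomial with exponent \<open>k\<close> by the value \<open>w k\<close>.\<close>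

definition lin_functional :: "('k \<Rightarrow> complex) \<Rightarrow> ('k \<Rightarrow>\<^sub>0 complex) \<Rightarrow> complex" where
  "lin_functional w p = (\<Sum>k\<in>Poly_Mapping.keys p. Poly_Mapping.lookup p k * w k)"

lemma lin_functional_0 [simp]: "lin_functional w 0 = 0"
  by (simp add: lin_functional_def)

lemma lin_functional_add: "lin_functional w (p + q) = lin_functional w p + lin_functional w q"
  unfolding lin_functional_def
  by (rule setsum_keys_plus_distrib) (simp_all add: algebra_simps)

lemma lin_functional_sum: "lin_functional w (\<Sum>i\<in>A. f i) = (\<Sum>i\<in>A. lin_functional w (f i))"
  by (induction A rule: infinite_finite_induct) (simp_all add: lin_functional_add)

lemma lin_functional_single: "lin_functional w (Poly_Mapping.single k c) = c * w k"
  by (cases "c = 0") (simp_all add: lin_functional_def)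

lemma lin_functional_sum_weights:
  "lin_functional (\<lambda>k. \<Sum>i\<in>A. w i k) p = (\<Sum>i\<in>A. lin_functional (w i) p)"
  unfolding lin_functional_def sum_distrib_left by (rule sum.swap)

text \<open>Multiplication by a monomial is dual to a shift of the weight, so products of
  polynomials translate into sums of shifted weights.\<close>

lemma lin_functional_mult_single:
  fixes k :: "'k :: monoid_add"
  shows "lin_functional w (Poly_Mapping.single k 1 * p) = lin_functional (\<lambda>l. w (k + l)) p"
proof (induction p rule: update_induct)
  case const
  then show ?case by simp
next
  case (update f a b)
  \<comment> \<open>The key \<open>a\<close> is new, so the update only adds one monomial and
    additivity applies.\<close>
  then have "Poly_Mapping.update a b f = f + Poly_Mapping.single a b"
    by (intro poly_mapping_eqI)
       (auto simp: lookup_update lookup_add lookup_single when_def in_keys_iff)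
  with update show ?case
    by (simp add: lin_functional_add distrib_left mult_single lin_functional_single)
qed

section \<open>Expansion of the product of the symbols of the partial derivatives\<close>

definition Var :: "nat \<Rightarrow> (nat \<Rightarrow>\<^sub>0 nat) \<Rightarrow>\<^sub>0 complex" where
  "Var i = Poly_Mapping.single (Poly_Mapping.single i 1) 1"

text \<open>The symbol of \<open>-\<partial>\<^sub>j\<close>: the sums \<open>T\<^sub>i\<close> that
  contain \<open>t\<^sub>j\<close> are those with \<open>j \<le> i \<le> r\<close>, and each
  contributes one variable.\<close>

definition tail_sum :: "nat \<Rightarrow> nat \<Rightarrow> (nat \<Rightarrow>\<^sub>0 nat) \<Rightarrow>\<^sub>0 complex" where
  "tail_sum r j = (\<Sum>i=j..r. Var i)"

lemma Var_power: "Var i ^ n = Poly_Mapping.single (Poly_Mapping.single i n) 1"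
proof (induction n)
  case 0
  then show ?case by simp
next
  case (Suc n)
  then show ?case
    by (simp add: Var_def mult_single flip: single_add)
qed

lemma prod_Var_power:
  "(\<Prod>i\<in>A. Var i ^ k i) = Poly_Mapping.single (\<Sum>i\<in>A. Poly_Mapping.single i (k i)) 1"
  by (induction A rule: infinite_finite_induct) (simp_all add: Var_power mult_single)

lemma lookup_sum_single:
  assumes "finite A" "i \<in> A"
  shows "Poly_Mapping.lookup (\<Sum>l\<in>A. Poly_Mapping.single l (k l)) i = k i"
  using assms by (simp add: lookup_sum lookup_single when_def)

lemma lin_functional_tail_sum_mult:
  "lin_functional w (tail_sum r j * p)
    = lin_functional (\<lambda>k. \<Sum>i=j..r. w (k + Poly_Mapping.single i 1)) p"
  by (simp add: tail_sum_def sum_distrib_right lin_functional_sum lin_functional_sum_weights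
      Var_def lin_functional_mult_single add.commute)

text \<open>Prefixes of index tuples: without the constraint on the total, tuples can be built one
  entry at a time.\<close>

definition admissible :: "nat \<Rightarrow> (nat \<Rightarrow> nat) set" where
  "admissible i = {k \<in> (\<Pi>\<^sub>E l\<in>{1..i}. {0..l}). \<forall>l\<in>{1..i}. (\<Sum>j=1..l. k j) \<le> l}"

text \<open>Variable \<open>l\<close> is picked from \<open>k l\<close> of those factors among the
  first \<open>l\<close> that earlier variables left over; this counts the choices.\<close>

definition distributions :: "nat \<Rightarrow> (nat \<Rightarrow> nat) \<Rightarrow> nat" where
  "distributions i k = (\<Prod>l=1..i. (l - (\<Sum>j=1..<l. k j)) choose k l)"

lemma finite_admissible: "finite (admissible i)"
  by (rule finite_subset[of _ "\<Pi>\<^sub>E l\<in>{1..i}. {0..l}"]) (auto simp: admissible_def intro!: finite_PiE)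

lemma sum_admissible_le: "k \<in> admissible i \<Longrightarrow> (\<Sum>l=1..i. k l) \<le> i"
  by (cases "i = 0") (auto simp: admissible_def)

text \<open>The constraint on the first \<open>Suc i\<close> entries bounds the new entry by what
  the earlier ones leave, which subsumes \<open>k (Suc i) \<le> Suc i\<close>.\<close>

lemma sum_admissible_Suc:
  fixes f :: "(nat \<Rightarrow> nat) \<Rightarrow> 'b :: comm_monoid_add"
  shows "(\<Sum>k\<in>admissible (Suc i). f k)
    = (\<Sum>k\<in>admissible i. \<Sum>q\<le>Suc i - (\<Sum>j=1..i. k j). f (k(Suc i := q)))"
proof -
  have upd: "(\<Sum>j=1..l. (k(Suc i := q)) j) = (\<Sum>j=1..l. k j)" if "l \<le> i" for k :: "nat \<Rightarrow> nat" and q l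
    using that by (intro sum.cong) auto
  have "(\<Sum>k\<in>admissible i. \<Sum>q\<le>Suc i - (\<Sum>j=1..i. k j). f (k(Suc i := q)))
      = (\<Sum>(k, q)\<in>(SIGMA k:admissible i. {..Suc i - (\<Sum>j=1..i. k j)}). f (k(Suc i := q)))"
    by (intro sum.Sigma) (auto simp: finite_admissible)
  also have "\<dots> = (\<Sum>k\<in>admissible (Suc i). f k)"
  \<comment> \<open>The value \<open>undefined\<close> at \<open>Suc i\<close> makes the shortened
    tuple extensional again.\<close>
  proof (rule sum.reindex_bij_witness[where
        i = "\<lambda>k. (k(Suc i := undefined), k (Suc i))" and j = "\<lambda>(k, q). k(Suc i := q)"])
    fix a assume a: "a \<in> (SIGMA k:admissible i. {..Suc i - (\<Sum>j=1..i. k j)})"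
    then obtain k q where kq: "a = (k, q)" "k \<in> admissible i" "q \<le> Suc i - (\<Sum>j=1..i. k j)"
      by auto
    have k: "k (Suc i) = undefined"
      using kq(2) by (auto simp: admissible_def PiE_def extensional_def)
    then show "((case a of (k, q) \<Rightarrow> k(Suc i := q))(Suc i := undefined),
        (case a of (k, q) \<Rightarrow> k(Suc i := q)) (Suc i)) = a"
      using kq(1) by auto
    have "(\<Sum>j=1..i. k j) \<le> i"
      using kq(2) by (rule sum_admissible_le)
    then have "(\<Sum>j=1..Suc i. (k(Suc i := q)) j) \<le> Suc i" "q \<le> Suc i"
      using kq(3) upd[of i k q] by auto
    then show "(case a of (k, q) \<Rightarrow> k(Suc i := q)) \<in> admissible (Suc i)"
      using kq(1,2) upd[of _ k q] by (auto simp: admissible_def PiE_def Pi_def extensional_def le_Suc_eq)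
  next
    fix k assume k: "k \<in> admissible (Suc i)"
    show "(case (k(Suc i := undefined), k (Suc i)) of (k, q) \<Rightarrow> k(Suc i := q)) = k"
      by simp
    have "\<forall>l\<in>{1..Suc i}. (\<Sum>j=1..l. k j) \<le> l"
      using k by (simp add: admissible_def)
    then have "(\<Sum>j=1..Suc i. k j) \<le> Suc i"
      by (rule bspec) simp
    then have "k (Suc i) \<le> Suc i - (\<Sum>j=1..i. (k(Suc i := undefined)) j)"
      using upd[of i k undefined] by auto
    moreover have "k(Suc i := undefined) \<in> admissible i"
      using k upd[of _ k undefined] by (auto simp: admissible_def PiE_def Pi_def extensional_def)
    ultimately show "(k(Suc i := undefined), k (Suc i)) \<in> (SIGMA k:admissible i. {..Suc i - (\<Sum>j=1..i. k j)})"
      by auto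
  qed auto
  finally show ?thesis ..
qed

text \<open>After variables 1 to \<open>i\<close> have been split off,
  \<open>i - (\<Sum>l=1..i. k l)\<close> of the first \<open>i\<close> factors are unassigned, and
  each of them has shrunk to \<open>tail_sum r (Suc i)\<close>. The next factor joins these, and the
  binomial theorem splits off \<open>Var (Suc i)\<close>.\<close>

lemma prod_tail_sum:
  assumes "i \<le> r"
  shows "(\<Prod>l=1..i. tail_sum r l) = (\<Sum>k\<in>admissible i.
    of_nat (distributions i k) * (\<Prod>l=1..i. Var l ^ k l) * tail_sum r (Suc i) ^ (i - (\<Sum>l=1..i. k l)))"
  using assms
proof (induction i)
  case 0
  have "admissible 0 = {\<lambda>_. undefined}"
    by (auto simp: admissible_def)
  then show ?case
    by (simp add: distributions_def)
next
  case (Suc i)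
  have binom: "tail_sum r (Suc i) ^ m
      = (\<Sum>q\<le>m. of_nat (m choose q) * Var (Suc i) ^ q * tail_sum r (Suc (Suc i)) ^ (m - q))" for m
    unfolding binomial_ring[symmetric] tail_sum_def
    using Suc.prems by (simp add: sum.atLeast_Suc_atMost)
  have "(\<Prod>l=1..Suc i. tail_sum r l) = (\<Sum>k\<in>admissible i. of_nat (distributions i k) *
      (\<Prod>l=1..i. Var l ^ k l) * tail_sum r (Suc i) ^ (Suc i - (\<Sum>l=1..i. k l)))"
    using Suc sum_admissible_le[of _ i] by (auto simp: sum_distrib_left sum_distrib_right Suc_diff_le mult_ac intro!: sum.cong)
  also have "\<dots> = (\<Sum>k\<in>admissible i. \<Sum>q\<le>Suc i - (\<Sum>l=1..i. k l).
      of_nat (distributions (Suc i) (k(Suc i := q))) * (\<Prod>l=1..Suc i. Var l ^ (k(Suc i := q)) l)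
        * tail_sum r (Suc (Suc i)) ^ (Suc i - (\<Sum>l=1..Suc i. (k(Suc i := q)) l)))"
    unfolding binom sum_distrib_left
  proof (intro sum.cong refl)
    fix k q
    have 1: "(\<Prod>l=1..i. Var l ^ (k(Suc i := q)) l) = (\<Prod>l=1..i. Var l ^ k l)"
      "(\<Sum>l=1..i. (k(Suc i := q)) l) = (\<Sum>l=1..i. k l)"
      by (auto intro: sum.cong prod.cong)
    have 2: "(\<Sum>l=1..<j. (k(Suc i := q)) l) = (\<Sum>l=1..<j. k l)" if "j \<le> Suc i" for j
      using that by (intro sum.cong) auto
    have 3: "distributions (Suc i) (k(Suc i := q))
        = distributions i k * ((Suc i - (\<Sum>l=1..i. k l)) choose q)"
    proof -
      have "(\<Prod>l=1..i. (l - (\<Sum>j=1..<l. (k(Suc i := q)) j)) choose (k(Suc i := q)) l) = distributions i k"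
        unfolding distributions_def by (intro prod.cong refl, subst 2) auto
      then show ?thesis
        unfolding distributions_def[of "Suc i"] using 2[of "Suc i"]
        by (simp add: atLeastLessThanSuc_atLeastAtMost del: fun_upd_apply) simp
    qed
    show "of_nat (distributions i k) * (\<Prod>l=1..i. Var l ^ k l) *
        (of_nat ((Suc i - (\<Sum>l=1..i. k l)) choose q) * Var (Suc i) ^ q *
          tail_sum r (Suc (Suc i)) ^ (Suc i - (\<Sum>l=1..i. k l) - q))
      = of_nat (distributions (Suc i) (k(Suc i := q))) * (\<Prod>l=1..Suc i. Var l ^ (k(Suc i := q)) l)
        * tail_sum r (Suc (Suc i)) ^ (Suc i - (\<Sum>l=1..Suc i. (k(Suc i := q)) l))"
      using 1 3 by (simp add: mult_ac)
  qed
  finally show ?case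
    by (simp only: sum_admissible_Suc)
qed

lemma index_tuples_eq: "index_tuples r = {k \<in> admissible r. (\<Sum>l=1..r. k l) = r}"
  by (auto simp: index_tuples_def admissible_def)

text \<open>For \<open>i = r\<close> the leftover factor \<open>tail_sum r (Suc r)\<close> is an
  empty sum, so only the tuples leaving it with power 0, those of total \<open>r\<close>,
  survive.\<close>

lemma lin_functional_prod_tail_sum:
  "lin_functional w (\<Prod>l=1..r. tail_sum r l)
    = (\<Sum>k\<in>index_tuples r. of_nat (distributions r k) * w (\<Sum>l=1..r. Poly_Mapping.single l (k l)))"
proof -
  have "tail_sum r (Suc r) = 0"
    by (simp add: tail_sum_def)
  then have "(\<Prod>l=1..r. tail_sum r l) = (\<Sum>k\<in>admissible r. if (\<Sum>l=1..r. k l) = r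
      then of_nat (distributions r k) * (\<Prod>l=1..r. Var l ^ k l) else 0)"
    unfolding prod_tail_sum[OF order_refl]
  proof (intro sum.cong refl)
    fix k assume "k \<in> admissible r"
    from sum_admissible_le[OF this] have "r - (\<Sum>l=1..r. k l) = 0 \<longleftrightarrow> (\<Sum>l=1..r. k l) = r"
      by linarith
    then show "of_nat (distributions r k) * (\<Prod>l=1..r. Var l ^ k l) *
        tail_sum r (Suc r) ^ (r - (\<Sum>l=1..r. k l)) =
        (if (\<Sum>l=1..r. k l) = r then of_nat (distributions r k) * (\<Prod>l=1..r. Var l ^ k l) else 0)"
      by (simp add: \<open>tail_sum r (Suc r) = 0\<close> power_0_left del: One_nat_def)
  qed
  also have "\<dots> = (\<Sum>k\<in>index_tuples r. of_nat (distributions r k) * (\<Prod>l=1..r. Var l ^ k l))"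
    unfolding index_tuples_eq by (simp only: sum.inter_filter[OF finite_admissible])
  also have "\<dots> = (\<Sum>k\<in>index_tuples r. Poly_Mapping.single
      (\<Sum>l=1..r. Poly_Mapping.single l (k l)) (of_nat (distributions r k)))"
    by (simp add: prod_Var_power mult_single flip: single_of_nat)
  finally show ?thesis
    by (simp add: lin_functional_sum lin_functional_single)
qed

section \<open>Mixed partial derivatives\<close>

text \<open>With \<open>T\<^sub>i = t\<^sub>1 + ... + t\<^sub>i\<close>, factor \<open>i\<close> is
  formally what \<open>T\<^sub>i powr - s\<^sub>i\<close> becomes when minus the derivative in
  \<open>T\<^sub>i\<close> is applied as often as \<open>k\<close> prescribes.\<close>

definition weight :: "nat \<Rightarrow> (nat \<Rightarrow> complex) \<Rightarrow> (nat \<Rightarrow> real) \<Rightarrow> (nat \<Rightarrow>\<^sub>0 nat) \<Rightarrow> complex" where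
  "weight r s t k = (\<Prod>i=1..r. pochhammer (s i) (Poly_Mapping.lookup k i) /
     complex_of_real (\<Sum>j=1..i. t j) powr (s i + of_nat (Poly_Mapping.lookup k i)))"

text \<open>Formally the result of applying \<open>-\<partial>\<^sub>1\<close>, ...,
  \<open>-\<partial>\<^sub>j\<close> to the product of all powers; it interpolates between that
  product at \<open>j = 0\<close> and the kernel at \<open>j = r\<close>.\<close>

definition mixed_deriv :: "nat \<Rightarrow> (nat \<Rightarrow> complex) \<Rightarrow> nat \<Rightarrow> (nat \<Rightarrow> real) \<Rightarrow> complex" where
  "mixed_deriv r s j t = lin_functional (weight r s t) (\<Prod>l=1..j. tail_sum r l)"

lemma weight_cong:
  assumes "\<And>i. i \<in> {1..r} \<Longrightarrow> t i = u i"
  shows "weight r s t = weight r s u"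
proof -
  have "(\<Sum>j=1..i. t j) = (\<Sum>j=1..i. u j)" if "i \<in> {1..r}" for i
    using assms that by (intro sum.cong) auto
  then show ?thesis
    unfolding weight_def by (intro ext prod.cong) auto
qed

lemma mixed_deriv_cong:
  assumes "\<And>i. i \<in> {1..r} \<Longrightarrow> t i = u i"
  shows "mixed_deriv r s j t = mixed_deriv r s j u"
  using weight_cong[of r t u s] assms by (simp add: mixed_deriv_def)

lemma mixed_deriv_0:
  "mixed_deriv r s 0 t = (\<Prod>i=1..r. 1 / complex_of_real (\<Sum>j=1..i. t j) powr s i)"
proof -
  have "lin_functional (weight r s t) (Poly_Mapping.single 0 1) = weight r s t 0"
    by (simp only: lin_functional_single mult_1)
  then show ?thesis
    by (simp add: mixed_deriv_def weight_def)
qed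

lemma distributions_alt:
  assumes "r \<ge> 1"
  shows "of_nat (distributions r k) = of_nat (1 choose k 1) *
    (\<Prod>i=2..r. of_nat ((i - (\<Sum>j=1..<i. k j)) choose k i) :: complex)"
  using assms by (simp add: distributions_def prod.atLeast_Suc_atMost numeral_2_eq_2)

lemma mixed_deriv_full:
  assumes "r \<ge> 1"
  shows "mixed_deriv r s r t = kernel r s t"
  unfolding mixed_deriv_def lin_functional_prod_tail_sum kernel_def distributions_alt[OF assms] weight_def
  by (intro sum.cong refl arg_cong2[of _ _ _ _ "(*)"] prod.cong) (simp_all add: lookup_sum_single)

lemma sum_upd:
  fixes u :: "nat \<Rightarrow> real"
  assumes "1 \<le> j" "j \<le> i"
  shows "(\<Sum>l=1..i. (u(j := x)) l) = (\<Sum>l\<in>{1..i} - {j}. u l) + x"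
proof -
  have "(\<Sum>l=1..i. (u(j := x)) l) = (u(j := x)) j + (\<Sum>l\<in>{1..i} - {j}. (u(j := x)) l)"
    using assms by (intro sum.remove) auto
  also have "(\<Sum>l\<in>{1..i} - {j}. (u(j := x)) l) = (\<Sum>l\<in>{1..i} - {j}. u l)"
    by (intro sum.cong) auto
  finally show ?thesis by simp
qed

lemma sum_upd_less:
  fixes u :: "nat \<Rightarrow> real"
  assumes "i < j"
  shows "(\<Sum>l=1..i. (u(j := x)) l) = (\<Sum>l=1..i. u l)"
  using assms by (intro sum.cong) auto

section \<open>Derivative with respect to one coordinate\<close>

lemma factor_has_field_derivative:
  assumes "0 < c + x"
  shows "((\<lambda>z. pochhammer s k / (complex_of_real c + z) powr (s + of_nat k)) has_field_derivative
     - (pochhammer s (Suc k) / (complex_of_real c + of_real x) powr (s + of_nat (Suc k))))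
     (at (of_real x))"
proof -
  \<comment> \<open>Positivity keeps the base off the branch cut of the complex power.\<close>
  have nz: "complex_of_real c + of_real x \<notin> \<real>\<^sub>\<le>\<^sub>0"
    using assms by (simp add: complex_nonpos_Reals_iff)
  have "((\<lambda>z. complex_of_real c + z) has_field_derivative 1) (at (of_real x))"
    by (auto intro!: derivative_eq_intros)
  note DERIV_cmult[OF DERIV_chain2[OF has_field_derivative_powr[OF nz] this], of "pochhammer s k" "- (s + of_nat k)"]
  also have "(\<lambda>z. pochhammer s k * (complex_of_real c + z) powr - (s + of_nat k))
      = (\<lambda>z. pochhammer s k / (complex_of_real c + z) powr (s + of_nat k))"
    by (simp only: powr_minus divide_inverse)
  also have "(complex_of_real c + of_real x) powr (- (s + of_nat k) - 1)
      = inverse ((complex_of_real c + of_real x) powr (s + of_nat (Suc k)))"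
  proof -
    have "- (s + of_nat k) - 1 = - (s + of_nat (Suc k))"
      by simp
    then show ?thesis by (simp only: powr_minus)
  qed
  \<comment> \<open>The factor \<open>s + of_nat k\<close> pulled down from the exponent extends
    \<open>pochhammer s k\<close> to \<open>pochhammer s (Suc k)\<close>.\<close>
  finally show ?thesis
    by (simp add: pochhammer_Suc divide_inverse algebra_simps)
qed

text \<open>The product rule over \<open>i\<close>; the sums with \<open>i < j\<close> do not
  contain coordinate \<open>j\<close>, so the terms start at \<open>i = j\<close>.\<close>

lemma weight_has_vector_derivative:
  assumes "1 \<le> j" and pos: "\<And>i. i \<in> {j..r} \<Longrightarrow> 0 < (\<Sum>l=1..i. (u(j := x)) l)"
  shows "((\<lambda>x. weight r s (u(j := x)) k) has_vector_derivative
    - (\<Sum>i=j..r. weight r s (u(j := x)) (k + Poly_Mapping.single i 1))) (at x)"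
proof -
  define c where "c i = (\<Sum>l\<in>{1..i} - {j}. u l)" for i
  \<comment> \<open>Extending the factors to a complex argument \<open>z\<close> gives access to
    complex differentiation; the real line is restored at the end.\<close>
  define f where "f k i z = (if i < j then pochhammer (s i) (Poly_Mapping.lookup k i) /
      complex_of_real (\<Sum>l=1..i. u l) powr (s i + of_nat (Poly_Mapping.lookup k i))
    else pochhammer (s i) (Poly_Mapping.lookup k i) /
      (complex_of_real (c i) + z) powr (s i + of_nat (Poly_Mapping.lookup k i)))" for k i z
  have weight: "weight r s (u(j := y)) k = (\<Prod>i=1..r. f k i (of_real y))" for y k
    unfolding weight_def f_def c_def
    using sum_upd[OF assms(1), of _ u y] sum_upd_less[of _ j u y]
    by (intro prod.cong refl) (auto simp: not_less simp del: fun_upd_apply of_real_sum)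
  define f' where "f' i = (if i < j then 0 else - f (k + Poly_Mapping.single i 1) i (of_real x))" for i
  have "((\<lambda>z. f k i z) has_field_derivative f' i) (at (of_real x))" if "i \<in> {1..r}" for i
  proof (cases "i < j")
    case True
    then show ?thesis by (simp add: f_def f'_def)
  next
    case False
    then have "0 < c i + x"
      using pos[of i] that sum_upd[OF assms(1), of i u x] by (simp add: c_def del: fun_upd_apply)
    from factor_has_field_derivative[OF this] False show ?thesis
      by (simp add: f_def f'_def lookup_add add.assoc)
  qed
  then have "((\<lambda>z. \<Prod>i=1..r. f k i z) has_field_derivative
      (\<Sum>i=1..r. f' i * (\<Prod>l\<in>{1..r} - {i}. f k l (of_real x)))) (at (of_real x))"
    by (rule has_field_derivative_prod)
  also have "(\<Sum>i=1..r. f' i * (\<Prod>l\<in>{1..r} - {i}. f k l (of_real x)))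
      = (\<Sum>i=j..r. f' i * (\<Prod>l\<in>{1..r} - {i}. f k l (of_real x)))"
    using assms(1) by (intro sum.mono_neutral_right) (auto simp: f'_def)
  also have "\<dots> = (\<Sum>i=j..r. - weight r s (u(j := x)) (k + Poly_Mapping.single i 1))"
  proof (intro sum.cong refl)
    fix i assume i: "i \<in> {j..r}"
    have "weight r s (u(j := x)) (k + Poly_Mapping.single i 1)
        = f (k + Poly_Mapping.single i 1) i (of_real x) *
          (\<Prod>l\<in>{1..r} - {i}. f (k + Poly_Mapping.single i 1) l (of_real x))"
      unfolding weight using i assms(1) by (intro prod.remove) auto
    also have "(\<Prod>l\<in>{1..r} - {i}. f (k + Poly_Mapping.single i 1) l (of_real x))
        = (\<Prod>l\<in>{1..r} - {i}. f k l (of_real x))"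
      by (intro prod.cong) (auto simp: f_def lookup_add lookup_single_not_eq)
    finally show "f' i * (\<Prod>l\<in>{1..r} - {i}. f k l (of_real x))
        = - weight r s (u(j := x)) (k + Poly_Mapping.single i 1)"
      using i by (simp add: f'_def del: fun_upd_apply)
  qed
  finally show ?thesis
    unfolding weight sum_negf
    by (rule has_vector_derivative_real_field)
qed

lemma lin_functional_weight_has_vector_derivative:
  assumes "1 \<le> j" and "\<And>i. i \<in> {j..r} \<Longrightarrow> 0 < (\<Sum>l=1..i. (u(j := x)) l)"
  shows "((\<lambda>x. lin_functional (weight r s (u(j := x))) p) has_vector_derivative
    - lin_functional (weight r s (u(j := x))) (tail_sum r j * p)) (at x)"
proof -
  have "((\<lambda>x. lin_functional (weight r s (u(j := x))) p) has_vector_derivative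
      (\<Sum>k\<in>Poly_Mapping.keys p. Poly_Mapping.lookup p k *
        - (\<Sum>i=j..r. weight r s (u(j := x)) (k + Poly_Mapping.single i 1)))) (at x)"
    unfolding lin_functional_def
    by (intro has_vector_derivative_sum has_vector_derivative_mult_right
      weight_has_vector_derivative[OF assms])
  then show ?thesis
    unfolding lin_functional_tail_sum_mult
    by (simp only: lin_functional_def mult_minus_right sum_negf)
qed

section \<open>Decay as one coordinate tends to infinity\<close>

lemma shifted_powr_ratio_tendsto_1:
  "((\<lambda>x::real. (c + x) powr - b * x powr b) \<longlongrightarrow> 1) at_top"
proof -
  have "((\<lambda>x. c / x) \<longlongrightarrow> 0) at_top"
    by (rule real_tendsto_divide_at_top[OF tendsto_const filterlim_ident])
  then have "((\<lambda>x. (c / x + 1) powr - b) \<longlongrightarrow> (0 + 1) powr - b) at_top"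
    by (intro tendsto_intros) auto
  moreover have "eventually (\<lambda>x. (c / x + 1) powr - b = (c + x) powr - b * x powr b) at_top"
    using eventually_gt_at_top[of "max 0 (- c)"]
  proof eventually_elim
    case (elim x)
    then have "c / x + 1 = (c + x) / x" "0 \<le> c + x" "0 \<le> x"
      by (auto simp: field_simps)
    then show ?case
      by (simp add: powr_divide powr_minus_divide)
  qed
  ultimately show ?thesis
    by (simp add: filterlim_cong[OF refl refl])
qed

text \<open>Single factors may grow, since only the sum of the real parts is known to be positive.
  Each factor with \<open>i \<ge> j\<close> is therefore multiplied by
  \<open>x powr Re (s i)\<close>, which gives it a finite limit; compensating for this leaves a
  negative power of \<open>x\<close>.\<close>

lemma weight_tendsto_0:
  assumes j: "1 \<le> j" "j \<le> r" and pos: "0 < (\<Sum>i=j..r. Re (s i))"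
  shows "((\<lambda>x. weight r s (u(j := x)) k) \<longlongrightarrow> 0) at_top"
proof -
  define f where "f i x = norm (pochhammer (s i) (Poly_Mapping.lookup k i) /
     complex_of_real (\<Sum>l=1..i. (u(j := x)) l) powr (s i + of_nat (Poly_Mapping.lookup k i)))" for i x
  define b where "b i = (if i < j then 0 else Re (s i))" for i
  have "\<exists>L. ((\<lambda>x. f i x * x powr b i) \<longlongrightarrow> L) at_top" if i: "i \<in> {1..r}" for i
  proof (cases "i < j")
    case True
    have "eventually (\<lambda>x. f i x * x powr b i = f i 0) at_top"
      using eventually_gt_at_top[of 0]
      by eventually_elim (use True sum_upd_less[OF True, of u] in \<open>simp add: f_def b_def del: fun_upd_apply\<close>)
    then show ?thesis
      by (intro exI) (rule tendsto_eventually)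
  next
    case False
    define c where "c = (\<Sum>l\<in>{1..i} - {j}. u l)"
    define n where "n = Poly_Mapping.lookup k i"
    have *: "eventually (\<lambda>x. f i x * x powr b i = norm (pochhammer (s i) n) *
        (((c + x) powr - Re (s i) * x powr Re (s i)) * inverse (c + x) ^ n)) at_top"
      using eventually_gt_at_top[of "max 0 (- c)"]
    proof eventually_elim
      case (elim x)
      then have "norm (complex_of_real (c + x) powr (s i + of_nat n)) = (c + x) powr Re (s i) * (c + x) ^ n"
        by (subst norm_powr_real_powr) (auto simp: powr_add powr_realpow)
      then show ?case
        using False j sum_upd[of j i u x] elim
        by (simp add: f_def b_def norm_divide n_def c_def powr_minus field_simps del: fun_upd_apply of_real_add)
    qed
    have "filterlim (\<lambda>x. c + x) at_top at_top"
      by (rule filterlim_tendsto_add_at_top[OF tendsto_const filterlim_ident])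
    then have "((\<lambda>x. inverse (c + x)) \<longlongrightarrow> 0) at_top"
      by (rule tendsto_inverse_0_at_top)
    \<comment> \<open>For \<open>n = 0\<close> the limit contains \<open>0 ^ 0 = 1\<close>, for
      \<open>n > 0\<close> it is 0; either way it is finite.\<close>
    then have "((\<lambda>x. norm (pochhammer (s i) n) *
        (((c + x) powr - Re (s i) * x powr Re (s i)) * inverse (c + x) ^ n)) \<longlongrightarrow>
        norm (pochhammer (s i) n) * (1 * 0 ^ n)) at_top"
      by (intro tendsto_mult tendsto_power tendsto_const shifted_powr_ratio_tendsto_1)
    then show ?thesis
      unfolding tendsto_cong[OF *, symmetric] by blast
  qed
  then obtain L where "\<And>i. i \<in> {1..r} \<Longrightarrow> ((\<lambda>x. f i x * x powr b i) \<longlongrightarrow> L i) at_top"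
    by metis
  then have "((\<lambda>x. \<Prod>i=1..r. f i x * x powr b i) \<longlongrightarrow> (\<Prod>i=1..r. L i)) at_top"
    by (intro tendsto_prod)
  moreover have "((\<lambda>x. x powr - (\<Sum>i=j..r. Re (s i))) \<longlongrightarrow> 0) at_top"
    using pos by (intro tendsto_neg_powr filterlim_ident) auto
  ultimately have "((\<lambda>x. (\<Prod>i=1..r. f i x * x powr b i) * x powr - (\<Sum>i=j..r. Re (s i))) \<longlongrightarrow> 0) at_top"
    using tendsto_mult by fastforce
  moreover have "eventually (\<lambda>x. (\<Prod>i=1..r. f i x * x powr b i) * x powr - (\<Sum>i=j..r. Re (s i))
      = norm (weight r s (u(j := x)) k)) at_top"
    using eventually_gt_at_top[of 0]
  proof eventually_elim
    case (elim x)
    have "(\<Sum>i=1..r. b i) = (\<Sum>i=j..r. b i)"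
      using j by (intro sum.mono_neutral_right) (auto simp: b_def)
    also have "\<dots> = (\<Sum>i=j..r. Re (s i))"
      by (intro sum.cong) (auto simp: b_def)
    finally have "(\<Prod>i=1..r. x powr b i) = x powr (\<Sum>i=j..r. Re (s i))"
      using elim by (simp flip: powr_sum)
    then show ?case
      using elim by (simp add: prod.distrib powr_minus weight_def f_def prod_norm del: fun_upd_apply)
  qed
  ultimately show ?thesis
    by (simp add: tendsto_norm_zero_iff filterlim_cong[OF refl refl])
qed

lemma lin_functional_weight_tendsto_0:
  assumes "1 \<le> j" "j \<le> r" "0 < (\<Sum>i=j..r. Re (s i))"
  shows "((\<lambda>x. lin_functional (weight r s (u(j := x))) p) \<longlongrightarrow> 0) at_top"
  unfolding lin_functional_def
  by (intro tendsto_null_sum tendsto_mult_right_zero weight_tendsto_0[OF assms])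

lemma sum_pos_coords_ge1:
  assumes "u \<in> coords_ge1 {1..r}" "1 \<le> i" "i \<le> r"
  shows "1 \<le> (\<Sum>l=1..i. u l)"
proof -
  have "u 1 \<le> (\<Sum>l=1..i. u l)"
    using assms
    by (intro member_le_sum) (auto simp: coords_ge1_def intro: order_trans[OF zero_le_one])
  then show ?thesis
    using assms by (force simp: coords_ge1_def)
qed

text \<open>The fundamental theorem of calculus on a half-line: the boundary term at infinity
  vanishes because the tail sum of the real parts is positive, so integration undoes one derivative
  and leaves the value at the lower endpoint.\<close>

lemma integral_mixed_deriv:
  fixes \<nu> :: real
  assumes j: "Suc j \<le> r" and pos: "0 < (\<Sum>i=Suc j..r. Re (s i))" and u: "u \<in> coords_ge1 {1..r}"
    and \<nu>: "1 \<le> \<nu>"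
    and int: "set_integrable lborel {\<nu>..} (\<lambda>x. mixed_deriv r s (Suc j) (u(Suc j := x)))"
  shows "(LINT x:{\<nu>..}|lborel. mixed_deriv r s (Suc j) (u(Suc j := x))) = mixed_deriv r s j (u(Suc j := \<nu>))"
proof -
  let ?f = "\<lambda>x. mixed_deriv r s (Suc j) (u(Suc j := x))"
  let ?F = "\<lambda>x. - mixed_deriv r s j (u(Suc j := x))"
  have deriv: "((\<lambda>x. lin_functional (weight r s (u(Suc j := x))) p) has_vector_derivative
      - lin_functional (weight r s (u(Suc j := x))) (tail_sum r (Suc j) * p)) (at x)" if "\<nu> \<le> x" for x p
  proof (rule lin_functional_weight_has_vector_derivative)
    have "u(Suc j := x) \<in> coords_ge1 {1..r}"
      using u \<nu> that by (auto simp: coords_ge1_def)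
    then show "0 < (\<Sum>l=1..i. (u(Suc j := x)) l)" if "i \<in> {Suc j..r}" for i
      using sum_pos_coords_ge1[of "u(Suc j := x)" r i] that by (simp del: fun_upd_apply)
  qed simp
  have F: "(?F has_vector_derivative ?f x) (at x)" if "\<nu> \<le> x" for x
    using has_vector_derivative_minus[OF deriv[OF that, of "\<Prod>l=1..j. tail_sum r l"]]
    unfolding mixed_deriv_def by (simp add: mult.commute del: fun_upd_apply)
  have cont: "isCont ?f x" if "\<nu> \<le> x" for x
    unfolding mixed_deriv_def by (rule has_vector_derivative_continuous[OF deriv[OF that]])
  have "(LBINT x=ereal \<nu>..\<infinity>. ?f x) = 0 - ?F \<nu>"
  proof (rule interval_integral_FTC_integrable)
    have "einterval (ereal \<nu>) \<infinity> = {\<nu><..}"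
      by auto
    then show "set_integrable lborel (einterval (ereal \<nu>) \<infinity>) ?f"
      using int by (auto intro: set_integrable_subset)
    have "isCont ?F \<nu>"
      by (rule has_vector_derivative_continuous[OF F]) simp
    then have "(?F \<longlongrightarrow> ?F \<nu>) (at_right \<nu>)"
      unfolding isCont_def by (rule filterlim_mono) (auto simp: at_within_le_at)
    then show "((?F \<circ> real_of_ereal) \<longlongrightarrow> ?F \<nu>) (at_right (ereal \<nu>))"
      unfolding ereal_tendsto_simps1 .
    have "(?F \<longlongrightarrow> - 0) at_top"
      unfolding mixed_deriv_def using j pos by (intro tendsto_minus lin_functional_weight_tendsto_0) auto
    then show "((?F \<circ> real_of_ereal) \<longlongrightarrow> 0) (at_left \<infinity>)"
      unfolding ereal_tendsto_simps1 by simp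
  qed (use F cont in auto)
  moreover have "(LINT x:{\<nu>..}|lborel. ?f x) = (LINT x:{\<nu><..}|lborel. ?f x)"
    unfolding set_lebesgue_integral_def
    by (rule integral_discrete_difference[where X = "{\<nu>}"]) (auto simp: indicator_def)
  ultimately show ?thesis
    by (simp add: interval_integral_to_infinity_eq)
qed

section \<open>Integrability of the kernel\<close>

text \<open>The branch cut rules out an argument by continuity on the whole line; on each sign of
  \<open>x\<close> the power is an explicit exponential.\<close>

lemma measurable_of_real_powr [measurable]: "(\<lambda>x. complex_of_real x powr z) \<in> borel_measurable borel"
proof -
  have "(\<lambda>x. complex_of_real x powr z) = (\<lambda>x. if x = 0 then 0 else
      if 0 < x then exp (z * complex_of_real (ln x))
      else (- 1) powr z * exp (z * complex_of_real (ln (- x))))"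
  proof
    fix x :: real
    have pos: "complex_of_real y powr z = exp (z * complex_of_real (ln y))" if "0 < y" for y
      using that by (simp add: powr_def Ln_of_real)
    show "complex_of_real x powr z = (if x = 0 then 0 else
      if 0 < x then exp (z * complex_of_real (ln x))
      else (- 1) powr z * exp (z * complex_of_real (ln (- x))))"
      using pos[of x] pos[of "- x"] powr_neg_real_complex[of "- x" z]
      by (cases x "0 :: real" rule: linorder_cases) auto
  qed
  also have "\<dots> \<in> borel_measurable borel"
    by measurable
  finally show ?thesis .
qed

lemma measurable_coord [measurable]: "(\<lambda>t. t i) \<in> borel_measurable assignments"
  by (rule measurable_component_singleton) simp

lemma kernel_measurable [measurable]: "kernel r s \<in> borel_measurable assignments"
  unfolding kernel_def by measurable

text \<open>The product of the \<open>T i\<close> turns into the right-hand side by moving factors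
  to larger indices, which only enlarges them; prefix sums of at most \<open>l\<close> ensure that
  none moves to a smaller index. Factors not yet placed are parked at index
  \<open>n\<close>.\<close>

lemma prod_le_prod_powers:
  fixes T :: "nat \<Rightarrow> real"
  assumes "\<And>l. l \<in> {1..n} \<Longrightarrow> (\<Sum>i=1..l. k i) \<le> l"
    and "\<And>l. l \<in> {1..n} \<Longrightarrow> 0 < T l" and "\<And>l. 1 \<le> l \<Longrightarrow> Suc l \<le> n \<Longrightarrow> T l \<le> T (Suc l)"
  shows "(\<Prod>i=1..n. T i) \<le> (\<Prod>i=1..n. T i ^ k i) * T n ^ (n - (\<Sum>i=1..n. k i))"
  using assms
proof (induction n)
  case 0
  then show ?case by simp
next
  case (Suc n)
  let ?m = "n - (\<Sum>i=1..n. k i)"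
  have k: "(\<Sum>i=1..n. k i) \<le> n"
    using Suc.prems(1)[of n] by (cases "n = 0") auto
  have k': "(\<Sum>i=1..Suc n. k i) \<le> Suc n"
    by (rule Suc.prems(1)) simp
  have "(\<Prod>i=1..Suc n. T i) \<le> (\<Prod>i=1..n. T i ^ k i) * T n ^ ?m * T (Suc n)"
    using Suc.prems(2)[of "Suc n"] Suc.IH Suc.prems by (simp add: mult_right_mono)
  also have "T n ^ ?m \<le> T (Suc n) ^ ?m"
  proof (cases "n = 0")
    case False
    then show ?thesis
      using Suc.prems(2)[of n] Suc.prems(3)[of n] by (intro power_mono) auto
  qed simp
  then have "(\<Prod>i=1..n. T i ^ k i) * T n ^ ?m * T (Suc n)
      \<le> (\<Prod>i=1..n. T i ^ k i) * T (Suc n) ^ ?m * T (Suc n)"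
    using Suc.prems(2)
    by (intro mult_right_mono mult_left_mono prod_nonneg zero_le_power) (auto simp: less_imp_le)
  \<comment> \<open>One more factor has become available, and \<open>k (Suc n)\<close> of the parked
    ones are placed at the new index.\<close>
  also have "T (Suc n) ^ ?m * T (Suc n) = T (Suc n) ^ (k (Suc n) + (Suc n - (\<Sum>i=1..Suc n. k i)))"
  proof -
    have "Suc ?m = k (Suc n) + (Suc n - (\<Sum>i=1..Suc n. k i))"
      using k k' by simp
    then show ?thesis
      by (simp only: power_Suc2[symmetric])
  qed
  then have "(\<Prod>i=1..n. T i ^ k i) * T (Suc n) ^ ?m * T (Suc n)
      = (\<Prod>i=1..Suc n. T i ^ k i) * T (Suc n) ^ (Suc n - (\<Sum>i=1..Suc n. k i))"
    by (simp add: power_add mult.assoc)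
  finally show ?case .
qed

text \<open>A tuple of total \<open>r\<close> leaves no factor parked, so the product of the
  \<open>T i\<close> is at most that of the \<open>T i ^ k i\<close>, and every summand is bounded
  by the one shape with each exponent raised by 1. The constant collects coefficients and Pochhammer
  symbols.\<close>

lemma kernel_bound:
  obtains C where "0 \<le> C"
    and "\<And>t. t \<in> coords_ge1 {1..r} \<Longrightarrow>
      norm (kernel r s t) \<le> C * (\<Prod>i=1..r. (\<Sum>j=1..i. t j) powr - (Re (s i) + 1))"
proof
  define c where "c k = (of_nat (1 choose k 1) * (\<Prod>i=2..r. of_nat ((i - (\<Sum>j=1..<i. k j)) choose k i)) :: complex)" for k
  define p where "p k = (\<Prod>i=1..r. norm (pochhammer (s i) (k i)))" for k
  let ?C = "\<Sum>k\<in>index_tuples r. norm (c k) * p k"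
  show "0 \<le> ?C"
    by (auto simp: p_def intro!: sum_nonneg mult_nonneg_nonneg prod_nonneg)
  fix t :: "nat \<Rightarrow> real" assume t: "t \<in> coords_ge1 {1..r}"
  define T where "T i = (\<Sum>j=1..i. t j)" for i
  have T: "0 < T i" if "i \<in> {1..r}" for i
    using sum_pos_coords_ge1[OF t, of i] that by (auto simp: T_def)
  have T_mono: "T l \<le> T (Suc l)" if "Suc l \<le> r" for l
    using t that by (auto simp: T_def coords_ge1_def intro: order_trans[OF zero_le_one])
  let ?B = "\<Prod>i=1..r. T i powr - (Re (s i) + 1)"
  have *: "(\<Prod>i=1..r. norm (pochhammer (s i) (k i) / complex_of_real (T i) powr (s i + of_nat (k i)))) \<le> p k * ?B"
    if k: "k \<in> index_tuples r" for k
  proof -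
    have sum: "(\<Sum>i=1..r. k i) = r" and "\<And>l. l \<in> {1..r} \<Longrightarrow> (\<Sum>i=1..l. k i) \<le> l"
      using k by (auto simp: index_tuples_def)
    from prod_le_prod_powers[of r k T, OF this(2) T T_mono]
    have le: "(\<Prod>i=1..r. T i) \<le> (\<Prod>i=1..r. T i ^ k i)"
      unfolding sum by simp
    have pos: "0 < (\<Prod>i=1..r. T i)"
      using T by (intro prod_pos) auto
    have "norm (pochhammer (s i) (k i) / complex_of_real (T i) powr (s i + of_nat (k i)))
        = norm (pochhammer (s i) (k i)) * T i powr - Re (s i) * inverse (T i ^ k i)" if "i \<in> {1..r}" for i
    proof -
      have "norm (complex_of_real (T i) powr (s i + of_nat (k i))) = T i powr Re (s i) * T i ^ k i"
        using T[OF that] by (subst norm_powr_real_powr) (auto simp: powr_add powr_realpow)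
      then show ?thesis
        by (simp add: norm_divide powr_minus field_simps)
    qed
    then have "(\<Prod>i=1..r. norm (pochhammer (s i) (k i) / complex_of_real (T i) powr (s i + of_nat (k i))))
        = (p k * (\<Prod>i=1..r. T i powr - Re (s i))) * inverse (\<Prod>i=1..r. T i ^ k i)"
      by (simp add: p_def prod.distrib prod_inversef[symmetric])
    also have "\<dots> \<le> (p k * (\<Prod>i=1..r. T i powr - Re (s i))) * inverse (\<Prod>i=1..r. T i)"
      using le pos by (intro mult_left_mono le_imp_inverse_le) (auto simp: p_def intro!: mult_nonneg_nonneg prod_nonneg)
    also have "\<dots> = p k * (\<Prod>i=1..r. T i powr - Re (s i) * inverse (T i))"
      by (simp add: prod.distrib prod_inversef[symmetric])
    also have "(\<Prod>i=1..r. T i powr - Re (s i) * inverse (T i)) = ?B"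
    proof (intro prod.cong refl)
      fix i assume "i \<in> {1..r}"
      have "T i powr - (Re (s i) + 1) = T i powr (- Re (s i) + - 1)"
        by simp
      then show "T i powr - Re (s i) * inverse (T i) = T i powr - (Re (s i) + 1)"
        using T[OF \<open>i \<in> {1..r}\<close>] by (simp only: powr_add powr_neg_one divide_inverse mult_1)
    qed
    finally show ?thesis .
  qed
  have "norm (kernel r s t) \<le> (\<Sum>k\<in>index_tuples r. norm (c k) *
      (\<Prod>i=1..r. norm (pochhammer (s i) (k i) / complex_of_real (T i) powr (s i + of_nat (k i)))))"
    unfolding kernel_def c_def T_def by (rule sum_norm_le) (simp add: norm_mult prod_norm del: of_real_sum)
  also have "\<dots> \<le> (\<Sum>k\<in>index_tuples r. norm (c k) * (p k * ?B))"
    by (intro sum_mono mult_left_mono *) auto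
  also have "\<dots> = ?C * ?B"
    by (simp add: sum_distrib_right mult.assoc)
  finally show "norm (kernel r s t) \<le> ?C * (\<Prod>i=1..r. (\<Sum>j=1..i. t j) powr - (Re (s i) + 1))"
    by (simp only: T_def)
qed

section \<open>Iterated integral of the majorant\<close>

lemma nn_integral_shifted_powr:
  fixes c \<tau> K :: real
  assumes "0 \<le> c" "0 < \<tau>" "0 \<le> K"
  shows "(\<integral>\<^sup>+x\<in>{1..}. ennreal (K * (c + x) powr (- \<tau> - 1)) \<partial>lborel) = ennreal (K / \<tau> * (c + 1) powr - \<tau>)"
proof -
  have "(\<integral>\<^sup>+x\<in>{1..}. ennreal (K * (c + x) powr (- \<tau> - 1)) \<partial>lborel)
      = ennreal (0 - (- (K / \<tau>) * (c + 1) powr - \<tau>))"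
  proof (rule nn_integral_FTC_atLeast)
    show "((\<lambda>x. - (K / \<tau>) * (c + x) powr - \<tau>) has_real_derivative K * (c + x) powr (- \<tau> - 1)) (at x)"
      if "1 \<le> x" for x
      using assms that by (auto intro!: derivative_eq_intros simp: field_simps)
    have "((\<lambda>x. (c + x) powr - \<tau>) \<longlongrightarrow> 0) at_top"
      using assms
      by (intro tendsto_neg_powr filterlim_tendsto_add_at_top[OF tendsto_const filterlim_ident]) auto
    then show "((\<lambda>x. - (K / \<tau>) * (c + x) powr - \<tau>) \<longlongrightarrow> 0) at_top"
      by (rule tendsto_mult_right_zero)
  qed (use assms in auto)
  then show ?thesis by simp
qed

text \<open>Downward induction on \<open>j\<close>. Integrating variable \<open>Suc j\<close> from 1
  turns \<open>(c + x) powr (- \<tau> - 1)\<close> into a multiple of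
  \<open>(c + 1) powr - \<tau>\<close>, where \<open>c\<close> is the sum of the outer variables;
  the summand 1 in the bound is this lower limit.\<close>

lemma iter_nn_finite_product_powr:
  fixes \<sigma> :: "nat \<Rightarrow> real"
  assumes H: "\<And>t. t \<in> coords_ge1 {1..r} \<Longrightarrow>
      H t \<le> ennreal (C * (\<Prod>i=1..r. (\<Sum>l=1..i. t l) powr - (\<sigma> i + 1)))"
    and C: "0 \<le> C"
    and \<sigma>: "\<And>j. 1 \<le> j \<Longrightarrow> j \<le> r \<Longrightarrow> 0 < (\<Sum>i=j..r. \<sigma> i)"
    and "j \<le> r"
  shows "\<exists>C\<ge>0. \<forall>t\<in>coords_ge1 {1..j}. iter_nn_finite [Suc j..<Suc r] H t \<and>
    iter_nn_integral [Suc j..<Suc r] H t \<le> ennreal (C *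
      (\<Prod>i=1..j. (\<Sum>l=1..i. t l) powr - (\<sigma> i + 1)) * ((\<Sum>l=1..j. t l) + 1) powr - (\<Sum>i=Suc j..r. \<sigma> i))"
  using \<open>j \<le> r\<close>
proof (induction rule: inc_induct)
  case base
  have "H t \<le> ennreal (C * (\<Prod>i=1..r. (\<Sum>l=1..i. t l) powr - (\<sigma> i + 1)) * ((\<Sum>l=1..r. t l) + 1) powr - 0)"
    and "H t < \<infinity>" if "t \<in> coords_ge1 {1..r}" for t
  proof -
    show "H t < \<infinity>"
      using H[OF that] by (rule order_le_less_trans) simp
    \<comment> \<open>A nonnegative sum makes the base \<open>(\<Sum>l=1..r. t l) + 1\<close>
      nonzero, so that its power with exponent 0 is 1.\<close>
    have "0 \<le> (\<Sum>l=1..r. t l)"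
      using that by (intro sum_nonneg) (auto simp: coords_ge1_def intro: order_trans[OF zero_le_one])
    then show "H t \<le> ennreal (C * (\<Prod>i=1..r. (\<Sum>l=1..i. t l) powr - (\<sigma> i + 1)) * ((\<Sum>l=1..r. t l) + 1) powr - 0)"
      using H[OF that] by simp
  qed
  then show ?case
    using C by (intro exI[of _ C]) auto
next
  case (step j)
  then obtain C where C: "0 \<le> C"
    and IH: "\<And>t. t \<in> coords_ge1 {1..Suc j} \<Longrightarrow> iter_nn_finite [Suc (Suc j)..<Suc r] H t"
      "\<And>t. t \<in> coords_ge1 {1..Suc j} \<Longrightarrow> iter_nn_integral [Suc (Suc j)..<Suc r] H t \<le> ennreal (C *
      (\<Prod>i=1..Suc j. (\<Sum>l=1..i. t l) powr - (\<sigma> i + 1)) *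
      ((\<Sum>l=1..Suc j. t l) + 1) powr - (\<Sum>i=Suc (Suc j)..r. \<sigma> i))"
    by blast
  define \<tau> where "\<tau> = (\<Sum>i=Suc j..r. \<sigma> i)"
  define \<tau>' where "\<tau>' = (\<Sum>i=Suc (Suc j)..r. \<sigma> i)"
  have \<tau>: "0 < \<tau>" "\<tau> = \<sigma> (Suc j) + \<tau>'"
    using \<sigma>[of "Suc j"] step.hyps by (auto simp: \<tau>_def \<tau>'_def sum.atLeast_Suc_atMost)
  \<comment> \<open>Beyond the last variable the tail is empty and \<tau>' is 0; otherwise it is
    positive.\<close>
  have \<tau>': "0 \<le> \<tau>'"
    using \<sigma>[of "Suc (Suc j)"] by (cases "Suc (Suc j) \<le> r") (auto simp: \<tau>'_def)
  have upt: "[Suc j..<Suc r] = Suc j # [Suc (Suc j)..<Suc r]"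
    using step.hyps by (intro upt_conv_Cons) auto
  show ?case
  \<comment> \<open>The division by \<tau> comes from the antiderivative.\<close>
  proof (intro exI[of _ "C / \<tau>"] conjI ballI)
    show "0 \<le> C / \<tau>"
      using C \<tau> by simp
    fix t assume t: "t \<in> coords_ge1 {1..j}"
    define B where "B = (\<Prod>i=1..j. (\<Sum>l=1..i. t l) powr - (\<sigma> i + 1))"
    define c where "c = (\<Sum>l=1..j. t l)"
    have c: "0 \<le> c"
      using t by (auto simp: c_def coords_ge1_def intro!: sum_nonneg intro: order_trans[OF zero_le_one])
    have B: "0 \<le> B"
      by (auto simp: B_def intro: prod_nonneg)
    have u: "t(Suc j := x) \<in> coords_ge1 {1..Suc j}" if "1 \<le> x" for x
      using t that by (auto simp: coords_ge1_def)
    have le: "iter_nn_integral [Suc (Suc j)..<Suc r] H (t(Suc j := x))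
        \<le> ennreal (C * B * (c + x) powr (- \<tau> - 1))" if x: "1 \<le> x" for x
    proof -
      have sums: "(\<Sum>l=1..i. (t(Suc j := x)) l) = (\<Sum>l=1..i. t l)" if "i \<le> j" for i
        using that by (intro sum_upd_less) auto
      then have Suc: "(\<Sum>l=1..Suc j. (t(Suc j := x)) l) = c + x"
        by (simp add: c_def)
      have "(\<Prod>i=1..j. (\<Sum>l=1..i. (t(Suc j := x)) l) powr - (\<sigma> i + 1)) = B"
        unfolding B_def by (intro prod.cong refl) (simp add: sums del: fun_upd_apply One_nat_def)
      then have prod: "(\<Prod>i=1..Suc j. (\<Sum>l=1..i. (t(Suc j := x)) l) powr - (\<sigma> i + 1))
          = B * (c + x) powr - (\<sigma> (Suc j) + 1)"
        using Suc by (simp del: fun_upd_apply)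
      \<comment> \<open>Dropping the summand 1 lets the two powers of \<open>c + x\<close> merge;
        the exponents add up to \<open>- \<tau> - 1\<close>.\<close>
      have "(c + x + 1) powr - \<tau>' \<le> (c + x) powr - \<tau>'"
        using c x \<tau>' by (intro powr_mono2') auto
      then have "C * (B * (c + x) powr - (\<sigma> (Suc j) + 1)) * (c + x + 1) powr - \<tau>'
          \<le> C * (B * (c + x) powr - (\<sigma> (Suc j) + 1)) * (c + x) powr - \<tau>'"
        using C B by (intro mult_left_mono) auto
      also have "\<dots> = C * B * (c + x) powr (- \<tau> - 1)"
      proof -
        have "(c + x) powr (- (\<sigma> (Suc j) + 1) + - \<tau>') = (c + x) powr (- \<tau> - 1)"
          using \<tau> by (intro arg_cong2[of _ _ _ _ "(powr)"]) auto
        then show ?thesis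
          by (simp only: powr_add mult.assoc)
      qed
      finally show ?thesis
        using IH(2)[OF u[OF x]] unfolding Suc prod \<tau>'_def[symmetric]
        by (meson order_trans ennreal_leI)
    qed
    have bound: "iter_nn_integral [Suc j..<Suc r] H t
        \<le> (\<integral>\<^sup>+x\<in>{1..}. ennreal (C * B * (c + x) powr (- \<tau> - 1)) \<partial>lborel)"
      unfolding upt iter_nn_integral.simps
      by (intro nn_integral_mono) (auto simp: indicator_def simp del: fun_upd_apply upt_Suc intro: le)
    also have "\<dots> = ennreal (C * B / \<tau> * (c + 1) powr - \<tau>)"
      using C B \<tau> c by (intro nn_integral_shifted_powr) auto
    finally have bound: "iter_nn_integral [Suc j..<Suc r] H t \<le> ennreal (C * B / \<tau> * (c + 1) powr - \<tau>)" .
    then have "iter_nn_integral [Suc j..<Suc r] H t < \<infinity>"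
      by (rule order_le_less_trans) simp
    then show "iter_nn_finite [Suc j..<Suc r] H t"
      using IH(1)[OF u] unfolding upt by (simp del: fun_upd_apply upt_Suc)
    show "iter_nn_integral [Suc j..<Suc r] H t \<le> ennreal (C / \<tau> *
        (\<Prod>i=1..j. (\<Sum>l=1..i. t l) powr - (\<sigma> i + 1)) *
        ((\<Sum>l=1..j. t l) + 1) powr - (\<Sum>i=Suc j..r. \<sigma> i))"
      using bound by (simp only: B_def[symmetric] c_def[symmetric] \<tau>_def[symmetric] times_divide_eq_left)
  qed
qed

section \<open>Summation under the integral\<close>

lemma region_D_tail_sum_pos:
  assumes "s \<in> region_D r" "1 \<le> j" "j \<le> r"
  shows "0 < (\<Sum>i=j..r. Re (s i))"
proof -
  have "r - (r - j) = j" "r - j \<le> r - 1"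
    using assms by auto
  then show ?thesis
    using assms(1) by (force simp: region_D_def)
qed

lemma kernel_iter_nn_finite:
  assumes "s \<in> region_D r" "0 \<le> B" "j \<le> r" "t \<in> coords_ge1 {1..j}"
  shows "iter_nn_finite [Suc j..<Suc r] (\<lambda>u. ennreal (B * norm (kernel r s u))) t"
proof -
  obtain C where C: "0 \<le> C" "\<And>t. t \<in> coords_ge1 {1..r} \<Longrightarrow>
      norm (kernel r s t) \<le> C * (\<Prod>i=1..r. (\<Sum>j=1..i. t j) powr - (Re (s i) + 1))"
    using kernel_bound[of r s] by blast
  have "ennreal (B * norm (kernel r s t))
      \<le> ennreal (B * C * (\<Prod>i=1..r. (\<Sum>j=1..i. t j) powr - (Re (s i) + 1)))"
    if "t \<in> coords_ge1 {1..r}" for t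
    unfolding mult.assoc by (intro ennreal_leI mult_left_mono C(2)[OF that] assms(2))
  from iter_nn_finite_product_powr[OF this _ region_D_tail_sum_pos[OF assms(1)] assms(3)]
  show ?thesis
    using assms C(1) by auto
qed

text \<open>One shape for all stages: \<open>W\<close> consists of steps for a single term of the
  series, involves truncated sums during a summation, and consists of the partial sum functions in
  the final integrand.\<close>

definition weighted :: "nat \<Rightarrow> (nat \<Rightarrow> complex) \<Rightarrow> (nat \<Rightarrow> real \<Rightarrow> complex) \<Rightarrow> (nat \<Rightarrow> real) \<Rightarrow> complex" where
  "weighted r s W t = (\<Prod>i=1..r. W i (t i)) * kernel r s t"

lemma weighted_measurable:
  assumes "\<And>i. i \<in> {1..r} \<Longrightarrow> W i \<in> borel_measurable borel"
  shows "weighted r s W \<in> borel_measurable assignments"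
  unfolding weighted_def
  by (intro borel_measurable_times borel_measurable_prod kernel_measurable
      measurable_compose[OF measurable_coord assms])

lemma norm_weighted_le:
  assumes "\<And>i x. i \<in> {1..r} \<Longrightarrow> norm (W i x) \<le> \<beta> i"
  shows "norm (weighted r s W t) \<le> (\<Prod>i=1..r. \<beta> i) * norm (kernel r s t)"
  unfolding weighted_def norm_mult prod_norm[symmetric]
  by (intro mult_right_mono prod_mono) (auto intro: assms[simplified])

lemma iter_integrable_weighted:
  assumes "s \<in> region_D r" "j \<le> r" "t \<in> coords_ge1 {1..j}"
    and W: "\<And>i. i \<in> {1..r} \<Longrightarrow> W i \<in> borel_measurable borel"
      "\<And>i x. i \<in> {1..r} \<Longrightarrow> norm (W i x) \<le> \<beta> i"
  shows "iter_integrable [Suc j..<Suc r] (weighted r s W) t"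
proof (rule iter_integrable_dominated[OF assms(3) weighted_measurable[OF W(1)]])
  have "0 \<le> (\<Prod>i=1..r. \<beta> i)"
    using W(2) by (intro prod_nonneg) (auto intro: order_trans[OF norm_ge_zero])
  then show "iter_nn_finite [Suc j..<Suc r] (\<lambda>u. ennreal ((\<Prod>i=1..r. \<beta> i) * norm (kernel r s u))) t"
    using assms by (intro kernel_iter_nn_finite)
qed (assumption, intro ennreal_leI norm_weighted_le W(2))

text \<open>The bounds \<beta> are uniform in \<open>N\<close>, so one multiple of
  \<open>norm (kernel r s u)\<close> dominates the whole sequence.\<close>

lemma iter_integral_weighted_tendsto:
  assumes s: "s \<in> region_D r"
    and W: "\<And>N i. i \<in> {1..r} \<Longrightarrow> W N i \<in> borel_measurable borel"
      "\<And>i. i \<in> {1..r} \<Longrightarrow> V i \<in> borel_measurable borel"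
      "\<And>N i x. i \<in> {1..r} \<Longrightarrow> norm (W N i x) \<le> \<beta> i"
      "\<And>i x. i \<in> {1..r} \<Longrightarrow> (\<lambda>N. W N i x) \<longlonglongrightarrow> V i x"
  shows "(\<lambda>N. iter_integral [1..<Suc r] (weighted r s (W N)) t)
    \<longlonglongrightarrow> iter_integral [1..<Suc r] (weighted r s V) t"
proof (rule iter_integral_dominated_convergence)
  show "t \<in> coords_ge1 {}"
    by (simp add: coords_ge1_def)
  have "0 \<le> (\<Prod>i=1..r. \<beta> i)"
    using W(3) by (intro prod_nonneg) (auto intro: order_trans[OF norm_ge_zero])
  then show "iter_nn_finite [1..<Suc r] (\<lambda>u. ennreal ((\<Prod>i=1..r. \<beta> i) * norm (kernel r s u))) t"
    using s kernel_iter_nn_finite[of s r _ 0 t] by (simp add: coords_ge1_def del: upt_Suc)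
  show "(\<lambda>N. weighted r s (W N) u) \<longlonglongrightarrow> weighted r s V u" for u
    unfolding weighted_def by (intro tendsto_mult_right tendsto_prod W(4))
qed (auto intro!: ennreal_leI norm_weighted_le W(3) weighted_measurable W(1,2) simp del: One_nat_def)

section \<open>A term of the series as an iterated integral\<close>

definition step :: "nat \<Rightarrow> real \<Rightarrow> complex" where
  "step \<nu> = indicator {real \<nu>..}"

lemma step_measurable [measurable]: "step \<nu> \<in> borel_measurable borel"
  unfolding step_def by measurable

lemma norm_step_le: "norm (step \<nu> x) \<le> 1"
  by (simp add: step_def indicator_def)

text \<open>
  Integrating out the variables from the innermost one outwards undoes the mixed partial
  derivatives one at a time.
\<close>

lemma iter_integral_steps_from:
  assumes s: "s \<in> region_D r" and r: "1 \<le> r" and \<nu>: "\<And>i. i \<in> {1..r} \<Longrightarrow> 1 \<le> \<nu> i"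
    and "j \<le> r" "t \<in> coords_ge1 {1..j}"
  shows "iter_integral [Suc j..<Suc r] (weighted r s (\<lambda>i. step (\<nu> i))) t
    = (\<Prod>i=1..j. step (\<nu> i) (t i)) * mixed_deriv r s j (\<lambda>i. if i \<le> j then t i else real (\<nu> i))"
  using assms(4,5)
proof (induction j arbitrary: t rule: inc_induct)
  case base
  have "mixed_deriv r s r (\<lambda>i. if i \<le> r then t i else real (\<nu> i)) = kernel r s t"
    unfolding mixed_deriv_full[OF r, symmetric] by (rule mixed_deriv_cong) auto
  then show ?case
    by (simp add: weighted_def)
next
  case (step j)
  \<comment> \<open>Each integration leaves the value at its lower endpoint, so the variables beyond
    \<open>j\<close> sit at \<open>\<nu> i\<close>.\<close>
  define v where "v i = (if i \<le> j then t i else real (\<nu> i))" for i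
  let ?p = "\<Prod>i=1..j. step (\<nu> i) (t i)"
  let ?I = "\<lambda>x. iter_integral [Suc (Suc j)..<Suc r] (weighted r s (\<lambda>i. step (\<nu> i))) (t(Suc j := x))"
  let ?n = "real (\<nu> (Suc j))"
  have upt: "[Suc j..<Suc r] = Suc j # [Suc (Suc j)..<Suc r]"
    using step.hyps by (intro upt_conv_Cons) auto
  have n: "1 \<le> ?n"
    using \<nu>[of "Suc j"] step.hyps by simp
  have v: "v \<in> coords_ge1 {1..r}"
    using step.prems \<nu> by (auto simp: v_def coords_ge1_def)
  have I: "?I x = ?p * (step (\<nu> (Suc j)) x * mixed_deriv r s (Suc j) (v(Suc j := x)))" if "1 \<le> x" for x
  proof -
    have "t(Suc j := x) \<in> coords_ge1 {1..Suc j}"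
      using step.prems that by (auto simp: coords_ge1_def)
    moreover have "(\<Prod>i=1..j. step (\<nu> i) ((t(Suc j := x)) i)) = ?p"
      by (intro prod.cong) auto
    moreover have "(\<lambda>i. if i \<le> Suc j then (t(Suc j := x)) i else real (\<nu> i)) = v(Suc j := x)"
      by (auto simp: v_def)
    ultimately show ?thesis
      using step.IH[of "t(Suc j := x)"]
      by (simp add: mult.assoc del: fun_upd_apply upt_Suc add: fun_upd_same)
  qed
  have "(LINT x:{1..}|lborel. ?I x) = ?p * mixed_deriv r s j v"
  \<comment> \<open>The product of the outer steps is 0 or 1. If it is 1, the inner integral agrees
    with the mixed derivative on \<open>{?n..}\<close> and vanishes below, so integrability of the
    latter follows from the domination of the former.\<close>
  proof (cases "?p = 0")
    case True
    have zero: "indicat_real {1..} x *\<^sub>R ?I x = 0" for x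
      using I[of x] True by (cases "1 \<le> x") (simp_all del: fun_upd_apply upt_Suc)
    then show ?thesis
      unfolding set_lebesgue_integral_def True zero by simp
  next
    case False
    have "?p = 1"
      using False by (intro prod.neutral) (auto simp: step_def indicator_def split: if_splits)
    then have I_eq: "indicat_real {1..} x *\<^sub>R ?I x
        = indicat_real {?n..} x *\<^sub>R mixed_deriv r s (Suc j) (v(Suc j := x))" for x
      using I[of x] n by (auto simp: step_def indicator_def simp del: fun_upd_apply upt_Suc)
    have "iter_integrable [Suc j..<Suc r] (weighted r s (\<lambda>i. step (\<nu> i))) t"
      using s step.prems step.hyps
      by (intro iter_integrable_weighted[where \<beta> = "\<lambda>_. 1"]) (auto intro: norm_step_le)
    then have "set_integrable lborel {1..} ?I"
      unfolding upt by (simp del: upt_Suc)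
    then have "set_integrable lborel {?n..} (\<lambda>x. mixed_deriv r s (Suc j) (v(Suc j := x)))"
      unfolding set_integrable_def I_eq .
    from integral_mixed_deriv[OF _ _ v n this] region_D_tail_sum_pos[OF s, of "Suc j"] step.hyps
    have "(LINT x:{?n..}|lborel. mixed_deriv r s (Suc j) (v(Suc j := x))) = mixed_deriv r s j (v(Suc j := ?n))"
      by auto
    also have "v(Suc j := ?n) = v"
      by (auto simp: v_def)
    finally show ?thesis
      using \<open>?p = 1\<close> unfolding set_lebesgue_integral_def I_eq by simp
  qed
  then show ?case
    unfolding upt by (simp add: v_def[abs_def] del: upt_Suc)
qed

lemma iter_integral_steps:
  assumes "s \<in> region_D r" "1 \<le> r" "\<And>i. i \<in> {1..r} \<Longrightarrow> 1 \<le> \<nu> i"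
  shows "iter_integral [1..<Suc r] (weighted r s (\<lambda>i. step (\<nu> i))) t
    = 1 / (\<Prod>i=1..r. of_nat (\<Sum>j=1..i. \<nu> j) powr s i)"
proof -
  have "(\<lambda>i. if i \<le> 0 then t i else real (\<nu> i)) i = real (\<nu> i)" if "i \<in> {1..r}" for i
    using that by auto
  then have "mixed_deriv r s 0 (\<lambda>i. if i \<le> 0 then t i else real (\<nu> i)) = mixed_deriv r s 0 (\<lambda>i. real (\<nu> i))"
    by (rule mixed_deriv_cong)
  then show ?thesis
    using iter_integral_steps_from[OF assms, where j = 0 and t = t]
    by (simp add: coords_ge1_def mixed_deriv_0 prod_dividef del: upt_Suc)
qed

section \<open>Partial sum functions as limits of step sums\<close>

lemma norm_partial_sum_le:
  assumes "0 \<le> \<alpha>" "\<And>t. 1 \<le> t \<Longrightarrow> norm (partial_sum b t) \<le> \<alpha>"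
  shows "norm (partial_sum b t) \<le> \<alpha>"
proof (cases "1 \<le> t")
  \<comment> \<open>Below 1 the sum is empty, so the bound assumed for \<open>t \<ge> 1\<close>
    extends to the whole line.\<close>
  case False
  then have "{m. 1 \<le> m \<and> real m \<le> t} = {}"
    by auto
  then have "partial_sum b t = 0"
    unfolding partial_sum_def by (simp only: sum.empty)
  then show ?thesis
    using assms by simp
qed (use assms in auto)

text \<open>Truncation at \<open>N\<close> merely caps the argument, so truncated sums inherit the
  bound on partial sums, uniformly in \<open>N\<close>.\<close>

lemma sum_steps_eq_partial_sum:
  "(\<Sum>m<N. b (Suc m) * step (Suc m) x) = partial_sum b (min x (real N))"
proof -
  have "(\<Sum>m<N. b (Suc m) * step (Suc m) x) = (\<Sum>m<N. if real (Suc m) \<le> x then b (Suc m) else 0)"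
    by (intro sum.cong) (auto simp: step_def indicator_def)
  also have "\<dots> = (\<Sum>m\<in>{m\<in>{..<N}. real (Suc m) \<le> x}. b (Suc m))"
    by (simp only: sum.inter_filter[OF finite_lessThan])
  also have "\<dots> = partial_sum b (min x (real N))"
    unfolding partial_sum_def
    by (rule sum.reindex_bij_witness[where i = "\<lambda>m. m - 1" and j = Suc]) auto
  finally show ?thesis .
qed

lemma sum_steps_tendsto_partial_sum:
  "(\<lambda>N. \<Sum>m<N. b (Suc m) * step (Suc m) x) \<longlonglongrightarrow> partial_sum b x"
proof (rule tendsto_eventually)
  have "eventually (\<lambda>N. x \<le> real N) sequentially"
    by (rule filterlim_real_sequentially[unfolded filterlim_at_top, rule_format])
  then show "eventually (\<lambda>N. (\<Sum>m<N. b (Suc m) * step (Suc m) x) = partial_sum b x) sequentially"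
    by eventually_elim (simp add: sum_steps_eq_partial_sum min_absorb1)
qed

lemma partial_sum_measurable [measurable]: "partial_sum b \<in> borel_measurable borel"
  by (rule borel_measurable_LIMSEQ_metric[OF _ sum_steps_tendsto_partial_sum]) measurable

section \<open>Interchange of series and integrals\<close>

lemma weighted_upd_sum:
  assumes "p \<in> {1..r}"
  shows "weighted r s (W(p := \<lambda>x. \<Sum>m\<in>A. f m x)) t = (\<Sum>m\<in>A. weighted r s (W(p := f m)) t)"
proof -
  have "(\<Prod>i=1..r. (W(p := g)) i (t i)) = g (t p) * (\<Prod>i\<in>{1..r} - {p}. W i (t i))" for g
  proof -
    have "(\<Prod>i=1..r. (W(p := g)) i (t i)) = (W(p := g)) p (t p) * (\<Prod>i\<in>{1..r} - {p}. (W(p := g)) i (t i))"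
      using assms by (intro prod.remove) auto
    also have "(\<Prod>i\<in>{1..r} - {p}. (W(p := g)) i (t i)) = (\<Prod>i\<in>{1..r} - {p}. W i (t i))"
      by (intro prod.cong) auto
    finally show ?thesis by simp
  qed
  then show ?thesis
    unfolding weighted_def by (simp only: sum_distrib_right)
qed

text \<open>The weights once the sums over the indices beyond \<open>j\<close> have been carried
  out: outer indices still contribute single terms, inner ones full partial sum functions.\<close>

definition fixed_weights ::
  "(nat \<Rightarrow> nat \<Rightarrow> complex) \<Rightarrow> nat \<Rightarrow> (nat \<Rightarrow> nat) \<Rightarrow> nat \<Rightarrow> real \<Rightarrow> complex" where
  "fixed_weights a j n i = (if i \<le> j then (\<lambda>x. a i (n i) * step (n i) x) else partial_sum (a i))"

lemma fixed_weights_Suc: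
  "fixed_weights a (Suc j) (n(Suc j := m))
    = (fixed_weights a j n)(Suc j := \<lambda>x. a (Suc j) m * step m x)"
  by (auto simp: fixed_weights_def fun_eq_iff)

lemma fixed_weights_measurable: "fixed_weights a j n i \<in> borel_measurable borel"
  by (cases "i \<le> j") (simp_all add: fixed_weights_def)

lemma norm_fixed_weights_le:
  assumes "\<And>t. norm (partial_sum (a i) t) \<le> \<alpha> i"
  shows "norm (fixed_weights a j n i x) \<le> max (norm (a i (n i))) (\<alpha> i)"
  using assms[of x] mult_left_mono[OF norm_step_le[of "n i" x], of "norm (a i (n i))"]
  by (auto simp: fixed_weights_def norm_mult)

text \<open>Downward induction on \<open>j\<close>. At every stage the integral runs over all
  \<open>r\<close> variables; summing over index \<open>Suc j\<close> only changes the weight in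
  that slot, from single step terms to the partial sum function.\<close>

lemma iter_suminf_Phi_term:
  fixes a :: "nat \<Rightarrow> nat \<Rightarrow> complex"
  assumes s: "s \<in> region_D r" and r: "1 \<le> r"
    and \<alpha>: "\<And>i t. i \<in> {1..r} \<Longrightarrow> norm (partial_sum (a i) t) \<le> \<alpha> i"
    and "j \<le> r" "\<forall>i\<in>{1..j}. 1 \<le> n i"
  shows "iter_summable [Suc j..<Suc r] (Phi_term r s a) n \<and>
    iter_suminf [Suc j..<Suc r] (Phi_term r s a) n
      = iter_integral [1..<Suc r] (weighted r s (fixed_weights a j n)) (\<lambda>_. 0)"
  using assms(4,5)
proof (induction j arbitrary: n rule: inc_induct)
  case base
  have "weighted r s (fixed_weights a r n)
      = (\<lambda>t. (\<Prod>i=1..r. a i (n i)) * weighted r s (\<lambda>i. step (n i)) t)"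
    by (auto simp: weighted_def fixed_weights_def prod.distrib)
  then have "iter_integral [1..<Suc r] (weighted r s (fixed_weights a r n)) (\<lambda>_. 0)
      = (\<Prod>i=1..r. a i (n i)) * (1 / (\<Prod>i=1..r. of_nat (\<Sum>j=1..i. n j) powr s i))"
    using base by (simp only: iter_integral_cmult iter_integral_steps[OF s r])
  then show ?case
    by (simp add: Phi_term_def)
next
  case (step j)
  let ?J = "\<lambda>W. iter_integral [1..<Suc r] (weighted r s W) (\<lambda>_. 0)"
  let ?W = "fixed_weights a j n"
  let ?f = "\<lambda>m x. a (Suc j) (Suc m) * step (Suc m) x"
  have upt: "[Suc j..<Suc r] = Suc j # [Suc (Suc j)..<Suc r]"
    using step.hyps by (intro upt_conv_Cons) auto
  have IH: "iter_summable [Suc (Suc j)..<Suc r] (Phi_term r s a) (n(Suc j := Suc m))"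
    "iter_suminf [Suc (Suc j)..<Suc r] (Phi_term r s a) (n(Suc j := Suc m)) = ?J (?W(Suc j := ?f m))" for m
  proof -
    have "\<forall>i\<in>{1..Suc j}. 1 \<le> (n(Suc j := Suc m)) i"
      using step.prems by (auto simp: le_Suc_eq)
    from step.IH[OF this]
    show "iter_summable [Suc (Suc j)..<Suc r] (Phi_term r s a) (n(Suc j := Suc m))"
      "iter_suminf [Suc (Suc j)..<Suc r] (Phi_term r s a) (n(Suc j := Suc m)) = ?J (?W(Suc j := ?f m))"
      by (simp_all only: fixed_weights_Suc)
  qed
  \<comment> \<open>Linearity in slot \<open>Suc j\<close> moves the finite sum inside the
    integral.\<close>
  have "(\<Sum>m<N. ?J (?W(Suc j := ?f m))) = ?J (?W(Suc j := \<lambda>x. \<Sum>m<N. ?f m x))" for N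
  proof -
    have "iter_integrable [Suc 0..<Suc r] (weighted r s (?W(Suc j := ?f m))) (\<lambda>_. 0)" for m
      unfolding fixed_weights_Suc[symmetric]
      by (rule iter_integrable_weighted[OF s, where \<beta> =
            "\<lambda>i. max (norm (a i ((n(Suc j := Suc m)) i))) (\<alpha> i)"])
         (auto simp: coords_ge1_def simp del: fun_upd_apply
           intro!: fixed_weights_measurable norm_fixed_weights_le \<alpha>)
    moreover have "weighted r s (?W(Suc j := \<lambda>x. \<Sum>m<N. ?f m x))
        = (\<lambda>t. \<Sum>m<N. weighted r s (?W(Suc j := ?f m)) t)"
      using step.hyps by (intro ext weighted_upd_sum) auto
    ultimately show ?thesis
      by (simp add: iter_integral_sum del: upt_Suc fun_upd_apply)
  qed
  moreover have "(\<lambda>N. ?J (?W(Suc j := \<lambda>x. \<Sum>m<N. ?f m x))) \<longlonglongrightarrow> ?J ?W"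
  proof (rule iter_integral_weighted_tendsto[OF s,
        where \<beta> = "\<lambda>i. max (norm (a i (n i))) (\<alpha> i)"])
    fix i assume i: "i \<in> {1..r}"
    show "(?W(Suc j := \<lambda>x. \<Sum>m<N. ?f m x)) i \<in> borel_measurable borel" for N
      by (cases "i = Suc j") (auto intro: fixed_weights_measurable)
    \<comment> \<open>In slot \<open>Suc j\<close> the truncated sum is a partial sum at a capped
      argument, hence bounded by \<open>\<alpha> (Suc j)\<close> for every \<open>N\<close>; this
      replaces absolute convergence.\<close>
    show "norm ((?W(Suc j := \<lambda>x. \<Sum>m<N. ?f m x)) i x) \<le> max (norm (a i (n i))) (\<alpha> i)" for N x
      using i \<alpha>[of "Suc j"] norm_fixed_weights_le[of a i \<alpha> j n x, OF \<alpha>[OF i]]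
      by (cases "i = Suc j") (auto simp: sum_steps_eq_partial_sum le_max_iff_disj)
    show "(\<lambda>N. (?W(Suc j := \<lambda>x. \<Sum>m<N. ?f m x)) i x) \<longlonglongrightarrow> ?W i x" for x
      by (cases "i = Suc j") (auto simp: fixed_weights_def intro: sum_steps_tendsto_partial_sum)
  qed (rule fixed_weights_measurable)
  ultimately have "(\<lambda>m. ?J (?W(Suc j := ?f m))) sums ?J ?W"
    unfolding sums_def by simp
  then show ?case
    unfolding upt using IH by (simp add: sums_iff del: fun_upd_apply upt_Suc)
qed

theorem theorem3:
  fixes r :: nat and a :: "nat \<Rightarrow> nat \<Rightarrow> complex" and s :: "nat \<Rightarrow> complex"
  assumes "r \<ge> 1"
    and "\<forall>j\<in>{1..r}. \<exists>\<alpha>::real. \<alpha> > 0 \<and> (\<forall>t::real. t \<ge> 1 \<longrightarrow> norm (partial_sum (a j) t) \<le> \<alpha>)"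
    and "s \<in> region_D r"
  shows "Phi_convergent r s a \<and>
    iter_integrable [1..<Suc r] (Phi_integrand r s a) (\<lambda>_. 0) \<and>
    Phi r s a = iter_integral [1..<Suc r] (Phi_integrand r s a) (\<lambda>_. 0)"
proof -
  have "\<forall>i\<in>{1..r}. \<exists>\<alpha>. \<forall>t. norm (partial_sum (a i) t) \<le> \<alpha>"
    using assms(2) norm_partial_sum_le by (meson less_imp_le)
  then obtain \<alpha> where \<alpha>: "norm (partial_sum (a i) t) \<le> \<alpha> i" if "i \<in> {1..r}" for i t
    by metis
  have integrand: "weighted r s (\<lambda>i. partial_sum (a i)) = Phi_integrand r s a"
    by (simp add: weighted_def Phi_integrand_def fun_eq_iff)
  \<comment> \<open>At \<open>j = 0\<close> no index is held fixed, so every weight is a partial sum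
    function.\<close>
  then have "weighted r s (fixed_weights a 0 (\<lambda>_. 0)) = Phi_integrand r s a"
    by (auto simp: weighted_def fixed_weights_def Phi_integrand_def intro!: prod.cong)
  moreover have "iter_integrable [Suc 0..<Suc r] (Phi_integrand r s a) (\<lambda>_. 0)"
    unfolding integrand[symmetric]
    by (rule iter_integrable_weighted[OF assms(3), where \<beta> = \<alpha>]) (auto simp: coords_ge1_def intro: \<alpha>)
  ultimately show ?thesis
    using iter_suminf_Phi_term[OF assms(3,1) \<alpha>, where j = 0 and n = "\<lambda>_. 0"]
    by (simp add: Phi_convergent_def Phi_def del: upt_Suc)
qed

end
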